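(* The following non-degenerate symmetric bilinear forms in $\mathrm{Ver}_4^+$ (for integers $m,n\ge 0$, each being a form on $m\mathbb{1}\oplus nP$) are pairwise non-isomorphic; i.e. two forms from the list that differ in their family (A)–(F), in $(m,n)$, or (within family (E) or within family (F)) in the parameter $y$, are not isomorphic: (A) $\alpha_1^m+\frac n2\,\beta_{2P}(0)$, where $m>0$ and $2\mid n$; (B) $\alpha_1^m+n\,\beta_P(0)$, where $m>0$ and $n>0$; (C) $\alpha_2^m+\frac n2\,\beta_{2P}(0)$, where $2\mid m$ and $2\mid n$; (D) $\alpha_2^m+\beta_{2P}(1)+\frac{n-2}{2}\,\beta_{2P}(0)$, where $2\mid m$, $2\mid n$ and $n\ge 2$; (E) $\alpha_2^m+n\,\beta_P(y)$, where $y\in\mathbb{K}$, $2\mid m$ and $n>0$; (F) $\alpha_2^m+(n-2)\,\beta_P(0)+\beta_P(1)+\beta_P(y)$, where $y\in\mathbb{K}$, $2\mid m$, $n\ge 2$ and $(1+y,n)\ne(0,2)$.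
   Context: $\mathbb{K}$ is an algebraically closed field of characteristic $2$. $\mathrm{Ver}_4^+$ is the symmetric tensor category whose objects are (finite-dimensional) modules over $A=\mathbb{K}[t]/(t^2)$, whose morphisms are linear maps commuting with $t$, with tensor product action $t.(u\otimes u')=(t.u)\otimes u'+u\otimes(t.u')$, unit object $\mathbb{1}=\mathbb{K}$ (with $t$ acting by $0$), and braiding $c_{U,U'}(u\otimes u')=u'\otimes u+(t.u')\otimes(t.u)$. $P$ is the two-dimensional indecomposable module, with basis $w,x$, $t.w=x$, $t.x=0$. Every object is isomorphic to $m\mathbb{1}\oplus nP$ for unique $m,n\ge0$. A bilinear form on $U$ is a morphism $\beta:U\otimes U\to\mathbb{1}$ (so $\beta(t.u,u')=\beta(u,t.u')$). It is symmetric if $\beta\circ c_{U,U}=\beta$, and non-degenerate if the induced map $U\to U^*$ is an isomorphism. Forms $\beta$ on $U$ and $\gamma$ on $U'$ are isomorphic (equivalent) if there is an isomorphism $\phi:U'\to U$ in $\mathrm{Ver}_4^+$ with $\gamma=\beta\circ(\phi\otimes\phi)$. The sum $\beta+\gamma$ is the orthogonal direct sum form on $U\oplus U'$, and $k\beta$ (for an integer $k\ge0$) is the sum of $k$ copies of $\beta$. Named forms: $\alpha_1^m$ is the form on $m\mathbb{1}$ with identity Gram matrix; $\alpha_2^m$ ($m$ even) is the form on $m\mathbb{1}$ whose Gram matrix is the block-diagonal sum of $m/2$ copies of $\begin{bmatrix}0&1\\1&0\end{bmatrix}$. For $y\in\mathbb{K}$, $\beta_P(y)$ is the form on $P$ with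 Gram matrix $\begin{bmatrix}y&1\\1&0\end{bmatrix}$ in the basis $w,\,t.w$. For $i\in\{0,1\}$, $\beta_{2P}(i)$ is the form on $2P$ with Gram matrix $\begin{bmatrix}i&0&0&1\\0&0&1&0\\0&1&0&0\\1&0&0&0\end{bmatrix}$ in a basis $w_1,\,t.w_1,\,w_2,\,t.w_2$. *)

theory Defs
  imports
    "HOL-Computational_Algebra.Computational_Algebra"
    "HOL-Library.Function_Algebras"
begin

section \<open>The category \<open>Ver\<^sub>4\<^sup>+\<close>\<close>

text \<open>
  A module over \<open>K[t]/(t^2)\<close> is a linear subspace \<open>carr\<close> of an ambient \<open>K\<close>-vector space
  (a type with addition and a scalar multiplication \<open>scl\<close>), together with the action \<open>act\<close> of
  \<open>t\<close>. Values of \<open>act\<close>, and of maps in general, are irrelevant outside \<open>carr\<close>.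
\<close>

record ('k, 'v) obj =
  carr :: "'v set"
  scl  :: "'k \<Rightarrow> 'v \<Rightarrow> 'v"
  act  :: "'v \<Rightarrow> 'v"

definition linear_on :: "('k, 'u::plus) obj \<Rightarrow> ('k, 'v::plus) obj \<Rightarrow> ('u \<Rightarrow> 'v) \<Rightarrow> bool" where
  "linear_on U V f \<longleftrightarrow>
     (\<forall>x\<in>carr U. f x \<in> carr V) \<and>
     (\<forall>x\<in>carr U. \<forall>y\<in>carr U. f (x + y) = f x + f y) \<and>
     (\<forall>c. \<forall>x\<in>carr U. f (scl U c x) = scl V c (f x))"

definition is_object :: "('k::field, 'v::ab_group_add) obj \<Rightarrow> bool" where
  "is_object U \<longleftrightarrow>
     vector_space (scl U) \<and>
     module.subspace (scl U) (carr U) \<and>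
     (\<exists>B. finite B \<and> carr U = module.span (scl U) B) \<and>
     linear_on U U (act U) \<and>
     (\<forall>u\<in>carr U. act U (act U u) = 0)"

definition morphism :: "('k, 'u::plus) obj \<Rightarrow> ('k, 'v::plus) obj \<Rightarrow> ('u \<Rightarrow> 'v) \<Rightarrow> bool" where
  "morphism U V f \<longleftrightarrow> linear_on U V f \<and> (\<forall>u\<in>carr U. f (act U u) = act V (f u))"

definition isomorphism :: "('k, 'u::plus) obj \<Rightarrow> ('k, 'v::plus) obj \<Rightarrow> ('u \<Rightarrow> 'v) \<Rightarrow> bool" where
  "isomorphism U V f \<longleftrightarrow>
     morphism U V f \<and>
     (\<exists>g. morphism V U g \<and> (\<forall>u\<in>carr U. g (f u) = u) \<and> (\<forall>v\<in>carr V. f (g v) = v))"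

definition isomorphic_obj :: "('k, 'u::plus) obj \<Rightarrow> ('k, 'v::plus) obj \<Rightarrow> bool" where
  "isomorphic_obj U V \<longleftrightarrow> (\<exists>f. isomorphism U V f)"

definition unit_obj :: "('k::field, 'k) obj" where
  "unit_obj = \<lparr>carr = UNIV, scl = (*), act = (\<lambda>_. 0)\<rparr>"

subsection \<open>Tensor products and the braiding\<close>

definition bilin :: "('k::field, 'u::plus) obj \<Rightarrow> ('k, 'v::plus) obj \<Rightarrow> ('u \<Rightarrow> 'v \<Rightarrow> 'k) set" where
  "bilin U V = {b. (\<forall>v\<in>carr V. linear_on U unit_obj (\<lambda>u. b u v)) \<and>
                   (\<forall>u\<in>carr U. linear_on V unit_obj (\<lambda>v. b u v))}"

text \<open>
  Over a field, \<open>U \<otimes> V\<close> embeds into the dual of the space of bilinear maps \<open>U \<times> V \<rightarrow> K\<close>: the pure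
  tensor \<open>u \<otimes> v\<close> is evaluation at \<open>(u, v)\<close>. So \<open>U \<otimes> V\<close> is modelled as the span of these
  evaluations, and a linear map out of \<open>U \<otimes> V\<close> is given by precomposition on bilinear maps.
  A tensor has value 0 at functions that are not bilinear on \<open>U \<times> V\<close>. The lemmas after the
  definitions give the effect on pure tensors.
\<close>

type_synonym ('k, 'u, 'v) tensor = "('u \<Rightarrow> 'v \<Rightarrow> 'k) \<Rightarrow> 'k"

definition pure_tensor ::
    "('k::field, 'u::plus) obj \<Rightarrow> ('k, 'v::plus) obj \<Rightarrow> 'u \<Rightarrow> 'v \<Rightarrow> ('k, 'u, 'v) tensor" where
  "pure_tensor U V u v = (\<lambda>b. if b \<in> bilin U V then b u v else 0)"

definition tensor_obj ::
    "('k::field, 'u::plus) obj \<Rightarrow> ('k, 'v::plus) obj \<Rightarrow> ('k, ('k, 'u, 'v) tensor) obj" where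
  "tensor_obj U V =
     \<lparr>carr = module.span (\<lambda>c \<xi> b. c * \<xi> b) {pure_tensor U V u v | u v. u \<in> carr U \<and> v \<in> carr V},
      scl = (\<lambda>c \<xi> b. c * \<xi> b),
      act = (\<lambda>\<xi> b. if b \<in> bilin U V
                   then \<xi> (\<lambda>u v. b (act U u) v) + \<xi> (\<lambda>u v. b u (act V v)) else 0)\<rparr>"

definition tensor_map ::
    "('k::field, 'u2::plus) obj \<Rightarrow> ('k, 'v2::plus) obj \<Rightarrow> ('u1 \<Rightarrow> 'u2) \<Rightarrow> ('v1 \<Rightarrow> 'v2) \<Rightarrow>
     ('k, 'u1, 'v1) tensor \<Rightarrow> ('k, 'u2, 'v2) tensor" where
  "tensor_map U2 V2 f g = (\<lambda>\<xi> b. if b \<in> bilin U2 V2 then \<xi> (\<lambda>u v. b (f u) (g v)) else 0)"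

definition braiding ::
    "('k::field, 'u::plus) obj \<Rightarrow> ('k, 'v::plus) obj \<Rightarrow>
     ('k, 'u, 'v) tensor \<Rightarrow> ('k, 'v, 'u) tensor" where
  "braiding U V =
     (\<lambda>\<xi> b. if b \<in> bilin V U then \<xi> (\<lambda>u v. b v u + b (act V v) (act U u)) else 0)"

lemma tensor_obj_act_pure:
  assumes "linear_on U U (act U)" "linear_on V V (act V)" "u \<in> carr U" "v \<in> carr V"
  shows "act (tensor_obj U V) (pure_tensor U V u v) =
           pure_tensor U V (act U u) v + pure_tensor U V u (act V v)"
  using assms
  by (auto simp: tensor_obj_def pure_tensor_def bilin_def linear_on_def unit_obj_def fun_eq_iff)

lemma tensor_map_pure:
  assumes "linear_on U1 U2 f" "linear_on V1 V2 g" "u \<in> carr U1" "v \<in> carr V1"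
  shows "tensor_map U2 V2 f g (pure_tensor U1 V1 u v) = pure_tensor U2 V2 (f u) (g v)"
  using assms
  by (auto simp: tensor_map_def pure_tensor_def bilin_def linear_on_def unit_obj_def fun_eq_iff)

lemma braiding_pure:
  assumes "linear_on U U (act U)" "linear_on V V (act V)" "u \<in> carr U" "v \<in> carr V"
  shows "braiding U V (pure_tensor U V u v) =
           pure_tensor V U v u + pure_tensor V U (act V v) (act U u)"
  using assms
  by (auto simp: braiding_def pure_tensor_def bilin_def linear_on_def unit_obj_def fun_eq_iff
        algebra_simps)

subsection \<open>Bilinear forms\<close>

text \<open>
  The antipode of \<open>K[t]/(t^2)\<close> sends \<open>t\<close> to \<open>-t = t\<close> (characteristic 2), hence there is no sign
  in the action on the dual. Functionals are extended by 0 outside the carrier.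
\<close>

definition dual_obj :: "('k::field, 'u::plus) obj \<Rightarrow> ('k, 'u \<Rightarrow> 'k) obj" where
  "dual_obj U =
     \<lparr>carr = {f. linear_on U unit_obj f \<and> (\<forall>u. u \<notin> carr U \<longrightarrow> f u = 0)},
      scl = (\<lambda>c f u. c * f u),
      act = (\<lambda>f u. if u \<in> carr U then f (act U u) else 0)\<rparr>"

type_synonym ('k, 'u) bform = "('k, 'u) obj \<times> (('k, 'u, 'u) tensor \<Rightarrow> 'k)"

definition bilinear_form :: "('k::field, 'u::ab_group_add) bform \<Rightarrow> bool" where
  "bilinear_form = (\<lambda>(U, \<beta>). is_object U \<and> morphism (tensor_obj U U) unit_obj \<beta>)"

definition symmetric_form :: "('k::field, 'u::plus) bform \<Rightarrow> bool" where
  "symmetric_form = (\<lambda>(U, \<beta>). \<forall>\<xi>\<in>carr (tensor_obj U U). \<beta> (braiding U U \<xi>) = \<beta> \<xi>)"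

definition nondegenerate_form :: "('k::field, 'u::plus) bform \<Rightarrow> bool" where
  "nondegenerate_form = (\<lambda>(U, \<beta>).
     isomorphism U (dual_obj U) (\<lambda>u u'. if u' \<in> carr U then \<beta> (pure_tensor U U u u') else 0))"

definition isomorphic_forms ::
    "('k::field, 'u::plus) bform \<Rightarrow> ('k, 'v::plus) bform \<Rightarrow> bool" where
  "isomorphic_forms = (\<lambda>(U, \<beta>) (U', \<gamma>).
     \<exists>\<phi>. isomorphism U' U \<phi> \<and>
         (\<forall>\<xi>\<in>carr (tensor_obj U' U'). \<gamma> \<xi> = \<beta> (tensor_map U U \<phi> \<phi> \<xi>)))"

subsection \<open>Orthogonal direct sums\<close>

text \<open>
  So that all sums live on one type, the concrete objects are subspaces of the sequence
  space \<open>K^\<nat>\<close>, and \<open>K^\<nat> \<oplus> K^\<nat>\<close> is identified with \<open>K^\<nat>\<close> by interleaving: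
  \<open>evens\<close> and \<open>odds\<close> are the two projections of a direct sum.
\<close>

definition evens :: "(nat \<Rightarrow> 'k) \<Rightarrow> nat \<Rightarrow> 'k" where "evens z = (\<lambda>i. z (2 * i))"
definition odds :: "(nat \<Rightarrow> 'k) \<Rightarrow> nat \<Rightarrow> 'k" where "odds z = (\<lambda>i. z (2 * i + 1))"
definition join :: "(nat \<Rightarrow> 'k) \<Rightarrow> (nat \<Rightarrow> 'k) \<Rightarrow> nat \<Rightarrow> 'k" where
  "join x y = (\<lambda>i. if even i then x (i div 2) else y (i div 2))"

lemma evens_join [simp]: "evens (join x y) = x"
  and odds_join [simp]: "odds (join x y) = y"
  and join_evens_odds [simp]: "join (evens z) (odds z) = z"
  by (auto simp: evens_def odds_def join_def fun_eq_iff elim!: evenE oddE)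

definition sum_obj :: "('k, nat \<Rightarrow> 'k) obj \<Rightarrow> ('k, nat \<Rightarrow> 'k) obj \<Rightarrow> ('k, nat \<Rightarrow> 'k) obj" where
  "sum_obj U V =
     \<lparr>carr = {z. evens z \<in> carr U \<and> odds z \<in> carr V},
      scl = (\<lambda>c z. join (scl U c (evens z)) (scl V c (odds z))),
      act = (\<lambda>z. join (act U (evens z)) (act V (odds z)))\<rparr>"

definition sum_form :: "('k::field, nat \<Rightarrow> 'k) bform \<Rightarrow> ('k, nat \<Rightarrow> 'k) bform \<Rightarrow>
    ('k, nat \<Rightarrow> 'k) bform"  (infixl "\<oplus>\<^sub>f" 65) where
  "\<beta> \<oplus>\<^sub>f \<gamma> =
     (sum_obj (fst \<beta>) (fst \<gamma>),
      \<lambda>\<xi>. snd \<beta> (tensor_map (fst \<beta>) (fst \<beta>) evens evens \<xi>) +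
          snd \<gamma> (tensor_map (fst \<gamma>) (fst \<gamma>) odds odds \<xi>))"

definition coord_obj :: "nat \<Rightarrow> ((nat \<Rightarrow> 'k) \<Rightarrow> nat \<Rightarrow> 'k) \<Rightarrow> ('k::field, nat \<Rightarrow> 'k) obj" where
  "coord_obj d T = \<lparr>carr = {z. \<forall>i\<ge>d. z i = 0}, scl = (\<lambda>c z i. c * z i), act = T\<rparr>"

definition ones_obj :: "nat \<Rightarrow> ('k::field, nat \<Rightarrow> 'k) obj" where
  "ones_obj m = coord_obj m (\<lambda>z. 0)"

text \<open>The object \<open>nP\<close>: coordinates \<open>2j\<close> and \<open>2j+1\<close> are those along \<open>w\<^sub>j\<close> and \<open>t.w\<^sub>j\<close>.\<close>

definition P_obj :: "nat \<Rightarrow> ('k::field, nat \<Rightarrow> 'k) obj" where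
  "P_obj n = coord_obj (2 * n) (\<lambda>z i. if i < 2 * n \<and> odd i then z (i - 1) else 0)"

definition zero_form :: "('k::field, nat \<Rightarrow> 'k) bform" where
  "zero_form = (ones_obj 0, \<lambda>\<xi>. 0)"

primrec copies :: "nat \<Rightarrow> ('k::field, nat \<Rightarrow> 'k) bform \<Rightarrow> ('k, nat \<Rightarrow> 'k) bform" where
  "copies 0 \<beta> = zero_form"
| "copies (Suc k) \<beta> = copies k \<beta> \<oplus>\<^sub>f \<beta>"

subsection \<open>The named forms\<close>

definition gram_form ::
    "nat \<Rightarrow> ('k::field, nat \<Rightarrow> 'k) obj \<Rightarrow> (nat \<Rightarrow> nat \<Rightarrow> 'k) \<Rightarrow> ('k, nat \<Rightarrow> 'k) bform" where
  "gram_form d U G = (U, \<lambda>\<xi>. \<xi> (\<lambda>u v. \<Sum>i<d. \<Sum>j<d. u i * G i j * v j))"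

definition alpha1 :: "nat \<Rightarrow> ('k::field, nat \<Rightarrow> 'k) bform" where
  "alpha1 m = gram_form m (ones_obj m) (\<lambda>i j. if i = j then 1 else 0)"

definition alpha2 :: "nat \<Rightarrow> ('k::field, nat \<Rightarrow> 'k) bform" where
  "alpha2 m = gram_form m (ones_obj m)
     (\<lambda>i j. if i div 2 = j div 2 then [[0, 1], [1, 0]] ! (i mod 2) ! (j mod 2) else 0)"

definition beta_P :: "'k::field \<Rightarrow> ('k, nat \<Rightarrow> 'k) bform" where
  "beta_P y = gram_form 2 (P_obj 1) (\<lambda>i j. [[y, 1], [1, 0]] ! i ! j)"

definition beta_2P :: "'k::field \<Rightarrow> ('k, nat \<Rightarrow> 'k) bform" where
  "beta_2P a = gram_form 4 (P_obj 2)
     (\<lambda>i j. [[a, 0, 0, 1],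
             [0, 0, 1, 0],
             [0, 1, 0, 0],
             [1, 0, 0, 0]] ! i ! j)"

subsection \<open>The list of forms\<close>

datatype 'k label =
  FamA nat nat | FamB nat nat | FamC nat nat | FamD nat nat | FamE nat nat 'k | FamF nat nat 'k

primrec admissible :: "'k::field label \<Rightarrow> bool" where
  "admissible (FamA m n) \<longleftrightarrow> m > 0 \<and> 2 dvd n"
| "admissible (FamB m n) \<longleftrightarrow> m > 0 \<and> n > 0"
| "admissible (FamC m n) \<longleftrightarrow> 2 dvd m \<and> 2 dvd n"
| "admissible (FamD m n) \<longleftrightarrow> 2 dvd m \<and> 2 dvd n \<and> n \<ge> 2"
| "admissible (FamE m n y) \<longleftrightarrow> 2 dvd m \<and> n > 0"
| "admissible (FamF m n y) \<longleftrightarrow> 2 dvd m \<and> n \<ge> 2 \<and> (1 + y, n) \<noteq> (0, 2)"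

primrec listed_form :: "'k::field label \<Rightarrow> ('k, nat \<Rightarrow> 'k) bform" where
  "listed_form (FamA m n) = alpha1 m \<oplus>\<^sub>f copies (n div 2) (beta_2P 0)"
| "listed_form (FamB m n) = alpha1 m \<oplus>\<^sub>f copies n (beta_P 0)"
| "listed_form (FamC m n) = alpha2 m \<oplus>\<^sub>f copies (n div 2) (beta_2P 0)"
| "listed_form (FamD m n) = alpha2 m \<oplus>\<^sub>f beta_2P 1 \<oplus>\<^sub>f copies ((n - 2) div 2) (beta_2P 0)"
| "listed_form (FamE m n y) = alpha2 m \<oplus>\<^sub>f copies n (beta_P y)"
| "listed_form (FamF m n y) = alpha2 m \<oplus>\<^sub>f copies (n - 2) (beta_P 0) \<oplus>\<^sub>f beta_P 1 \<oplus>\<^sub>f beta_P y"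

primrec ones_mult :: "'k label \<Rightarrow> nat" where
  "ones_mult (FamA m n) = m"
| "ones_mult (FamB m n) = m"
| "ones_mult (FamC m n) = m"
| "ones_mult (FamD m n) = m"
| "ones_mult (FamE m n y) = m"
| "ones_mult (FamF m n y) = m"

primrec P_mult :: "'k label \<Rightarrow> nat" where
  "P_mult (FamA m n) = n"
| "P_mult (FamB m n) = n"
| "P_mult (FamC m n) = n"
| "P_mult (FamD m n) = n"
| "P_mult (FamE m n y) = n"
| "P_mult (FamF m n y) = n"

end

theory Submission
  imports Defs
begin

text \<open>
  The multiplicities \<open>m\<close> and \<open>n\<close> are read off the dimensions \<open>m + 2n\<close> of \<open>U\<close> and \<open>n\<close> of \<open>t.U\<close>.
  The form \<open>\<beta>\<close> is recovered up to family and parameter from the additive functions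
  \<open>q(u) = \<beta>(u, u)\<close> and \<open>r(u) = \<beta>(u, t.u)\<close>: exactly in families (A) and (B), \<open>q\<close> is non-zero on the
  kernel of \<open>t\<close>; exactly in (A), (C) and (D), \<open>r = 0\<close>. Then (C) and (D) differ by \<open>q = 0\<close> or not,
  and (E) is characterised by \<open>q = y r\<close>. In (F), \<open>r(u) = \<beta>(u, t.e)\<^sup>2\<close> for some \<open>e\<close>, unique up to
  the kernel of \<open>t\<close>, and \<open>q(e) = 1 + y\<close>.
\<close>

text \<open>In characteristic 2 squaring is additive, and \<open>r(c u) = c^2 r(u)\<close>, so
  \<open>r\<close> can be the square of a linear functional. For (F) the vector \<open>e\<close> is
  the sum of the vectors w of all n copies of P: then \<beta>(u, t.e) is the sum of the
  w-coordinates of u, its square is \<open>r(u)\<close>, and \<open>q(e)\<close> adds up the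
  diagonal entries 0, ..., 0, 1, y. On these vectors w the ratio \<open>q / r\<close> takes the
  values 1, y and, for n > 2, also 0. It is constant only for n = 2 and y = 1, the excluded case, in
  which the form is \<alpha>_2^m + 2 \<beta>_P(1) and already belongs to (E).

  The obstacle is the encoding. A form is a function on tensors, and tensors are themselves
  functionals, whereas \<open>q\<close> and \<open>r\<close> only see pairs of vectors. The
  predicate \<open>good_form\<close> mediates: it speaks about pairs of vectors, implies the
  categorical notions, and is preserved by orthogonal sums. These sums interleave coordinates, so
  the carriers are supported on scattered index sets and reach the shape m1 + nP only up to
  isomorphism.\<close>

interpretation fs: vector_space "\<lambda>c (f :: 'a \<Rightarrow> 'k::field) x. c * f x"
  by unfold_locales (auto simp: fun_eq_iff algebra_simps)

section \<open>Isomorphisms of objects\<close>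

lemma linear_onD:
  assumes "linear_on U V f"
  shows "x \<in> carr U \<Longrightarrow> f x \<in> carr V"
    and "x \<in> carr U \<Longrightarrow> y \<in> carr U \<Longrightarrow> f (x + y) = f x + f y"
    and "x \<in> carr U \<Longrightarrow> f (scl U c x) = scl V c (f x)"
  using assms by (auto simp: linear_on_def)

lemma morphismD:
  assumes "morphism U V f"
  shows "x \<in> carr U \<Longrightarrow> f x \<in> carr V"
    and "x \<in> carr U \<Longrightarrow> y \<in> carr U \<Longrightarrow> f (x + y) = f x + f y"
    and "x \<in> carr U \<Longrightarrow> f (scl U c x) = scl V c (f x)"
    and "x \<in> carr U \<Longrightarrow> f (act U x) = act V (f x)"
  using assms by (auto simp: morphism_def linear_on_def)

lemma isomorphic_obj_refl: "isomorphic_obj U U"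
  unfolding isomorphic_obj_def isomorphism_def morphism_def linear_on_def
  by (intro exI[of _ id]) auto

lemma isomorphic_obj_sym: "isomorphic_obj U V \<Longrightarrow> isomorphic_obj V U"
  unfolding isomorphic_obj_def isomorphism_def by blast

lemma morphism_comp: "morphism U V f \<Longrightarrow> morphism V W g \<Longrightarrow> morphism U W (\<lambda>x. g (f x))"
  unfolding morphism_def linear_on_def by auto

lemma isomorphic_obj_trans:
  assumes "isomorphic_obj U V" "isomorphic_obj V W"
  shows "isomorphic_obj U W"
proof -
  obtain f f' where f: "morphism U V f" "morphism V U f'"
      "\<forall>u\<in>carr U. f' (f u) = u" "\<forall>v\<in>carr V. f (f' v) = v"
    using assms(1) unfolding isomorphic_obj_def isomorphism_def by auto
  obtain g g' where g: "morphism V W g" "morphism W V g'"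
      "\<forall>u\<in>carr V. g' (g u) = u" "\<forall>v\<in>carr W. g (g' v) = v"
    using assms(2) unfolding isomorphic_obj_def isomorphism_def by auto
  have "isomorphism U W (\<lambda>x. g (f x))"
    unfolding isomorphism_def
    by (intro conjI exI[of _ "\<lambda>x. f' (g' x)"] morphism_comp[OF f(1) g(1)]
          morphism_comp[OF g(2) f(2)])
      (use f g morphismD(1)[OF f(1)] morphismD(1)[OF g(2)] in auto)
  then show ?thesis
    unfolding isomorphic_obj_def by blast
qed

lemma isomorphism_inj_on: "isomorphism U V f \<Longrightarrow> inj_on f (carr U)"
  unfolding isomorphism_def by (metis inj_onI)

lemma evens_add [simp]: "evens (x + y) = evens x + evens y"
  and odds_add [simp]: "odds (x + y) = odds x + odds y"
  and evens_zero [simp]: "evens 0 = 0"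
  and odds_zero [simp]: "odds 0 = 0"
  by (auto simp: evens_def odds_def fun_eq_iff)

lemma join_add: "join (a + b) (c + d) = join a c + (join b d :: nat \<Rightarrow> 'k::plus)"
  by (auto simp: join_def fun_eq_iff)

lemma join_zero [simp]: "join 0 0 = (0 :: nat \<Rightarrow> 'k::zero)"
  by (auto simp: join_def fun_eq_iff)

lemma join_eq_iff: "z = join x y \<longleftrightarrow> evens z = x \<and> odds z = y"
  by (metis evens_join odds_join join_evens_odds)

lemma join_eq_zero_iff [simp]: "join x y = (0 :: nat \<Rightarrow> 'k::zero) \<longleftrightarrow> x = 0 \<and> y = 0"
  by (metis evens_join evens_zero join_zero odds_join odds_zero)

lemma sum_obj_sel [simp]:
  "carr (sum_obj U V) = {z. evens z \<in> carr U \<and> odds z \<in> carr V}"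
  "scl (sum_obj U V) = (\<lambda>c z. join (scl U c (evens z)) (scl V c (odds z)))"
  "act (sum_obj U V) = (\<lambda>z. join (act U (evens z)) (act V (odds z)))"
  by (simp_all add: sum_obj_def)

lemma morphism_sum:
  assumes "morphism U U' f" "morphism V V' g"
  shows "morphism (sum_obj U V) (sum_obj U' V')
           (\<lambda>z. join (f (evens z)) (g (odds z :: nat \<Rightarrow> 'k::plus)) :: nat \<Rightarrow> 'k)"
  using morphismD[OF assms(1)] morphismD[OF assms(2)]
  by (auto simp: morphism_def linear_on_def join_add)

lemma isomorphic_obj_sum:
  fixes U V U' V' :: "('k::plus, nat \<Rightarrow> 'k) obj"
  assumes "isomorphic_obj U U'" "isomorphic_obj V V'"
  shows "isomorphic_obj (sum_obj U V) (sum_obj U' V')"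
proof -
  obtain f f' where f: "morphism U U' f" "morphism U' U f'"
      "\<forall>u\<in>carr U. f' (f u) = u" "\<forall>v\<in>carr U'. f (f' v) = v"
    using assms(1) unfolding isomorphic_obj_def isomorphism_def by auto
  obtain g g' where g: "morphism V V' g" "morphism V' V g'"
      "\<forall>u\<in>carr V. g' (g u) = u" "\<forall>v\<in>carr V'. g (g' v) = v"
    using assms(2) unfolding isomorphic_obj_def isomorphism_def by auto
  have "isomorphism (sum_obj U V) (sum_obj U' V') (\<lambda>z. join (f (evens z)) (g (odds z)))"
    unfolding isomorphism_def
    by (intro conjI exI[of _ "\<lambda>z. join (f' (evens z)) (g' (odds z))"]
          morphism_sum[OF f(1) g(1)] morphism_sum[OF f(2) g(2)]) (use f g in auto)
  then show ?thesis
    unfolding isomorphic_obj_def by blast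
qed

text \<open>Interleaving is associative only up to a permutation of the coordinates, hence an
  isomorphism and not an equation.\<close>

lemma isomorphic_obj_sum_assoc:
  fixes U V W :: "('k::plus, nat \<Rightarrow> 'k) obj"
  shows "isomorphic_obj (sum_obj (sum_obj U V) W) (sum_obj U (sum_obj V W))"
proof -
  let ?f = "\<lambda>z. join (evens (evens z)) (join (odds (evens z)) (odds z))"
  let ?g = "\<lambda>z. join (join (evens z) (evens (odds z))) (odds (odds z))"
  have "isomorphism (sum_obj (sum_obj U V) W) (sum_obj U (sum_obj V W)) ?f"
    unfolding isomorphism_def morphism_def linear_on_def
    by (intro conjI exI[of _ ?g]) (auto simp: join_add)
  then show ?thesis
    unfolding isomorphic_obj_def by blast
qed

text \<open>\<open>?f\<close> concatenates the two blocks of coordinates instead of interleaving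
  them. The offset \<open>2 * a\<close> is even, so each pair w_j, t.w_j keeps the parities that the
  action on \<open>P_obj\<close> relies on.\<close>

lemma isomorphic_obj_sum_P:
  "isomorphic_obj (sum_obj (P_obj a) (P_obj b)) (P_obj (a + b) :: ('k::field, nat \<Rightarrow> 'k) obj)"
proof -
  let ?f = "\<lambda>z :: nat \<Rightarrow> 'k. (\<lambda>i. if i < 2 * a then evens z i else odds z (i - 2 * a))"
  let ?g = "\<lambda>y :: nat \<Rightarrow> 'k. join (\<lambda>i. if i < 2 * a then y i else 0) (\<lambda>i. y (i + 2 * a))"
  have add: "?g (x + y) = ?g x + ?g y" for x y
    unfolding join_add[symmetric] by (intro arg_cong2[of _ _ _ _ join]) auto
  have act: "?g (act (P_obj (a + b)) x) = act (sum_obj (P_obj a) (P_obj b)) (?g x)" for x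
    unfolding sum_obj_sel evens_join odds_join
    by (intro arg_cong2[of _ _ _ _ join] ext)
      (auto simp: P_obj_def coord_obj_def Nat.diff_add_assoc2 elim: oddE)
  have scl: "?g (scl (P_obj (a + b)) c x) = scl (sum_obj (P_obj a) (P_obj b)) c (?g x)" for c x
    unfolding sum_obj_sel evens_join odds_join
    by (intro arg_cong2[of _ _ _ _ join] ext) (auto simp: P_obj_def coord_obj_def)
  have "?f z \<in> carr (P_obj (a + b))" if "z \<in> carr (sum_obj (P_obj a) (P_obj b))" for z
    using that by (auto simp: P_obj_def coord_obj_def)
  moreover have "?g z \<in> carr (sum_obj (P_obj a) (P_obj b))" if "z \<in> carr (P_obj (a + b))" for z
    using that by (auto simp: P_obj_def coord_obj_def)
  moreover have "?f (act (sum_obj (P_obj a) (P_obj b)) z) = act (P_obj (a + b)) (?f z)" for z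
    unfolding sum_obj_sel evens_join odds_join
    by (rule ext) (auto simp: P_obj_def coord_obj_def, presburger+)
  moreover have "?g (?f z) = z" if "z \<in> carr (sum_obj (P_obj a) (P_obj b))" for z
    using that by (subst eq_commute) (auto simp: join_eq_iff P_obj_def coord_obj_def)
  ultimately have "isomorphism (sum_obj (P_obj a) (P_obj b)) (P_obj (a + b)) ?f"
    unfolding isomorphism_def morphism_def linear_on_def
    by (intro conjI exI[of _ ?g] ballI allI add act scl) (auto simp: P_obj_def coord_obj_def)
  then show ?thesis
    unfolding isomorphic_obj_def by blast
qed

text \<open>Serves for the map to the dual, whose inverse has no convenient formula. The closure
  assumptions put x + y, c x and t.x back into the carrier, where \<open>inv_into\<close> undoes
  \<open>f\<close>.\<close>

lemma isomorphism_if_bij_betw: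
  assumes f: "morphism U V f" and bij: "bij_betw f (carr U) (carr V)"
    and add: "\<And>x y. x \<in> carr U \<Longrightarrow> y \<in> carr U \<Longrightarrow> x + y \<in> carr U"
    and scl: "\<And>c x. x \<in> carr U \<Longrightarrow> scl U c x \<in> carr U"
    and act: "\<And>x. x \<in> carr U \<Longrightarrow> act U x \<in> carr U"
  shows "isomorphism U V f"
proof -
  let ?g = "inv_into (carr U) f"
  have img: "f ` carr U = carr V" and inj: "inj_on f (carr U)"
    using bij by (auto simp: bij_betw_def)
  have gf: "?g (f u) = u" if "u \<in> carr U" for u
    using that inj by (rule inv_into_f_f[rotated])
  have "morphism V U ?g"
    unfolding morphism_def linear_on_def img[symmetric]
    by (auto simp: gf add scl act simp flip: morphismD(2,3,4)[OF f])
  then show ?thesis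
    unfolding isomorphism_def using f gf img by (auto intro!: exI[of _ ?g] f_inv_into_f)
qed

section \<open>Coordinate subspaces\<close>

definition unit_vec :: "nat \<Rightarrow> nat \<Rightarrow> 'k::field" where
  "unit_vec i = (\<lambda>j. if j = i then 1 else 0)"

text \<open>Interleaving scatters initial segments of indices, so arbitrary index sets are
  needed.\<close>

definition supported :: "nat set \<Rightarrow> (nat \<Rightarrow> 'k::field) set" where
  "supported A = {z. \<forall>i. i \<notin> A \<longrightarrow> z i = 0}"

text \<open>Preserved by \<open>sum_obj\<close>, and it supplies an explicit basis of unit vectors
  where \<open>is_object\<close> only asserts some finite spanning set.\<close>

definition coordinate_obj :: "('k::field, nat \<Rightarrow> 'k) obj \<Rightarrow> bool" where
  "coordinate_obj U \<longleftrightarrow>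
     scl U = (\<lambda>c z i. c * z i) \<and> (\<exists>A. finite A \<and> carr U = supported A) \<and>
     linear_on U U (act U) \<and> (\<forall>u\<in>carr U. act U (act U u) = 0)"

lemma linear_on_zero:
  fixes V :: "('k, 'v::ab_group_add) obj"
  assumes "linear_on U V f" "(0 :: 'u::ab_group_add) \<in> carr U"
  shows "f 0 = 0"
  using linear_onD(2)[OF assms(1), of 0 0] assms(2) by simp

text \<open>\<open>A\<close> is decoupled from the carrier so that the induction can shrink it while
  \<open>U\<close> stays fixed.\<close>

lemma linear_on_expansion:
  fixes V :: "('k::field, 'v::ab_group_add) obj"
  assumes lin: "linear_on U V f" and scl: "scl U = (\<lambda>c z i. c * z i)"
    and "finite A" "supported A \<subseteq> carr U" "z \<in> supported A"
  shows "f z = (\<Sum>i\<in>A. scl V (z i) (f (unit_vec i)))"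
  using assms(3-)
proof (induction A arbitrary: z rule: finite_induct)
  case empty
  then have "z = 0" by (auto simp: supported_def)
  with empty show ?case using linear_on_zero[OF lin] by (auto simp: zero_fun_def)
next
  case (insert a A)
  let ?z = "z(a := 0)"
  have sub: "supported A \<subseteq> carr U"
    using insert.prems(1) by (auto simp: supported_def)
  have z': "?z \<in> supported A" using insert.prems(2) by (auto simp: supported_def)
  have e: "unit_vec a \<in> carr U"
    using insert.prems(1) by (auto simp: supported_def unit_vec_def)
  have ze: "scl U (z a) (unit_vec a) \<in> carr U"
    using insert.prems(1) by (auto simp: supported_def unit_vec_def scl)
  have "z = ?z + scl U (z a) (unit_vec a)"
    by (auto simp: scl unit_vec_def)
  then have "f z = f ?z + scl V (z a) (f (unit_vec a))"
    using linear_onD(2)[OF lin _ ze, of ?z] linear_onD(3)[OF lin e] sub z' by (metis subsetD)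
  also have "f ?z = (\<Sum>i\<in>A. scl V (z i) (f (unit_vec i)))"
    unfolding insert.IH[OF sub z'] using insert.hyps by (auto intro!: sum.cong)
  finally show ?case using insert.hyps by (simp add: add.commute)
qed

lemma supported_span:
  assumes "finite A"
  shows "supported A = fs.span (unit_vec ` A :: (nat \<Rightarrow> 'k::field) set)"
proof
  let ?U = "\<lparr>carr = supported A, scl = (\<lambda>c z i. c * z i), act = id\<rparr> :: ('k, nat \<Rightarrow> 'k) obj"
  have "linear_on ?U ?U id" by (auto simp: linear_on_def supported_def)
  \<comment> \<open>For the identity map, the expansion writes \<open>z\<close> itself in unit
    vectors.\<close>
  from linear_on_expansion[OF this _ assms]
  have expand: "z = (\<Sum>i\<in>A. (\<lambda>j. z i * unit_vec i j))" if "z \<in> supported A" for z :: "nat \<Rightarrow> 'k"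
    using that by simp
  have mem: "(\<Sum>i\<in>A. (\<lambda>j. z i * unit_vec i j)) \<in> fs.span (unit_vec ` A)" for z :: "nat \<Rightarrow> 'k"
    by (intro fs.span_sum fs.span_scale fs.span_base) auto
  show "supported A \<subseteq> fs.span (unit_vec ` A :: (nat \<Rightarrow> 'k) set)"
  proof
    fix z :: "nat \<Rightarrow> 'k" assume "z \<in> supported A"
    then show "z \<in> fs.span (unit_vec ` A)"
      using mem[of z] by (simp only: expand[symmetric])
  qed
  show "fs.span (unit_vec ` A :: (nat \<Rightarrow> 'k) set) \<subseteq> supported A"
    by (intro fs.span_minimal fs.subspaceI) (auto simp: supported_def unit_vec_def)
qed

lemma coordinate_objD:
  assumes "coordinate_obj U"
  shows "scl U = (\<lambda>c z i. c * z i)" "linear_on U U (act U)"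
    and "0 \<in> carr U"
    and "x \<in> carr U \<Longrightarrow> y \<in> carr U \<Longrightarrow> x + y \<in> carr U"
    and "x \<in> carr U \<Longrightarrow> scl U c x \<in> carr U"
    and "x \<in> carr U \<Longrightarrow> act U x \<in> carr U"
    and "x \<in> carr U \<Longrightarrow> y \<in> carr U \<Longrightarrow> act U (x + y) = act U x + act U y"
    and "x \<in> carr U \<Longrightarrow> act U (act U x) = 0"
    and "act U 0 = 0"
proof -
  show "0 \<in> carr U" "linear_on U U (act U)"
    using assms by (auto simp: coordinate_obj_def supported_def)
  then show "act U 0 = 0" by (intro linear_on_zero[of U U])
qed (use assms in \<open>auto simp: coordinate_obj_def supported_def linear_on_def\<close>)

lemma is_object_coordinate:
  assumes "coordinate_obj U"
  shows "is_object U"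
proof -
  obtain A where A: "finite A" "carr U = supported A"
    using assms by (auto simp: coordinate_obj_def)
  show ?thesis
    unfolding is_object_def coordinate_objD(1)[OF assms]
    using assms A supported_span[OF A(1)] fs.subspace_span[of "unit_vec ` A"]
      fs.vector_space_axioms
    by (auto simp: coordinate_obj_def intro!: exI[of _ "unit_vec ` A"])
qed

lemma coordinate_obj_sum:
  assumes "coordinate_obj U" "coordinate_obj V"
  shows "coordinate_obj (sum_obj U V)"
proof -
  obtain A B where AB: "finite A" "carr U = supported A" "finite B" "carr V = supported B"
    using assms by (auto simp: coordinate_obj_def)
  let ?C = "(\<lambda>i. 2 * i) ` A \<union> (\<lambda>i. 2 * i + 1) ` B"
  have "carr (sum_obj U V) = supported ?C"
  proof -
    \<comment> \<open>Indices are split by parity, the way \<open>evens\<close> and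
      \<open>odds\<close> read them.\<close>
    have parity: "(\<forall>k. Q k) \<longleftrightarrow> (\<forall>i. Q (2 * i)) \<and> (\<forall>i. Q (2 * i + 1))" for Q :: "nat \<Rightarrow> bool"
      by (metis evenE oddE)
    have "2 * i \<in> ?C \<longleftrightarrow> i \<in> A" "2 * i + 1 \<in> ?C \<longleftrightarrow> i \<in> B" for i
      by (auto, presburger+)
    then show ?thesis
      unfolding sum_obj_sel AB supported_def evens_def odds_def parity[of "\<lambda>k. k \<notin> ?C \<longrightarrow> _ k"]
      by auto
  qed
  moreover have "linear_on (sum_obj U V) (sum_obj U V) (act (sum_obj U V))"
    using coordinate_objD(2)[OF assms(1)] coordinate_objD(2)[OF assms(2)]
    by (auto simp: linear_on_def join_add)
  moreover have "join (\<lambda>i. c * evens z i) (\<lambda>i. c * odds z i) = (\<lambda>i. c * z i)" for c and z :: "nat \<Rightarrow> 'a"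
    by (subst eq_commute) (auto simp: join_eq_iff evens_def odds_def)
  moreover have "\<forall>u\<in>carr (sum_obj U V). act (sum_obj U V) (act (sum_obj U V) u) = 0"
    using coordinate_objD(8)[OF assms(1)] coordinate_objD(8)[OF assms(2)] by auto
  moreover have "finite ?C"
    using AB by auto
  ultimately show ?thesis
    unfolding coordinate_obj_def sum_obj_sel(2) coordinate_objD(1)[OF assms(1)]
      coordinate_objD(1)[OF assms(2)]
    by blast
qed

text \<open>Steinitz exchange: the images of the unit vectors are independent and lie in the span of
  the unit vectors indexed by \<open>B\<close>.\<close>

lemma linear_inj_card_le:
  fixes U V :: "('k::field, nat \<Rightarrow> 'k) obj"
  assumes lin: "linear_on U V f" and inj: "inj_on f (carr U)"
    and scl: "scl U = (\<lambda>c z i. c * z i)" "scl V = (\<lambda>c z i. c * z i)"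
    and A: "finite A" "carr U = supported A" and B: "finite B" "carr V = supported B"
  shows "card A \<le> card B"
proof -
  have e: "unit_vec i \<in> carr U" if "i \<in> A" for i
    using that by (auto simp: A supported_def unit_vec_def)
  have inj_e: "inj_on (\<lambda>i. f (unit_vec i)) A"
  proof (rule inj_onI)
    fix i j assume ij: "i \<in> A" "j \<in> A" "f (unit_vec i) = f (unit_vec j)"
    then have "(unit_vec i :: nat \<Rightarrow> 'k) = unit_vec j"
      using inj e by (meson inj_onD)
    then have "unit_vec i i = (unit_vec j i :: 'k)"
      by simp
    then show "i = j" by (auto simp: unit_vec_def split: if_splits)
  qed
  let ?S = "(\<lambda>i. f (unit_vec i)) ` A"
  have "fs.independent ?S"
  proof (rule fs.independent_if_scalars_zero)
    show "finite ?S" using A by simp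
    fix c x assume *: "(\<Sum>x\<in>?S. (\<lambda>j. c x * x j)) = 0" and "x \<in> ?S"
    then obtain i where i: "i \<in> A" "x = f (unit_vec i)" by auto
    \<comment> \<open>The vanishing combination of images is \<open>f ?z\<close>, its coefficients
      being the coordinates of \<open>?z\<close>; injectivity then forces
      \<open>?z = 0\<close>.\<close>
    let ?z = "\<lambda>i. if i \<in> A then c (f (unit_vec i)) else 0"
    have z: "?z \<in> supported A" by (auto simp: supported_def)
    have "f ?z = (\<Sum>i\<in>A. (\<lambda>j. c (f (unit_vec i)) * f (unit_vec i) j))"
      using linear_on_expansion[OF lin scl(1) A(1) _ z] A by (auto simp: scl intro!: sum.cong)
    also have "\<dots> = 0"
      using * by (simp add: sum.reindex[OF inj_e] o_def)
    also have "\<dots> = f 0"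
      using linear_on_zero[OF lin] by (simp add: A supported_def)
    finally have "?z = 0"
      using inj z by (auto simp: A supported_def dest!: inj_onD)
    from fun_cong[OF this, of i] show "c x = 0" using i by simp
  qed
  moreover have "?S \<subseteq> fs.span (unit_vec ` B)"
    using linear_onD(1)[OF lin] e by (auto simp: supported_span[OF B(1), symmetric] B(2)[symmetric])
  ultimately have "card ?S \<le> card (unit_vec ` B :: (nat \<Rightarrow> 'k) set)"
    using fs.independent_span_bound[of "unit_vec ` B" ?S] B(1) by auto
  then show ?thesis
    using card_image[OF inj_e] card_image_le[OF B(1), of unit_vec] by (metis order_trans)
qed

section \<open>The multiplicities as dimensions\<close>

lemma ones_obj_sel [simp]:
  "carr (ones_obj m) = supported {..<m}" "scl (ones_obj m) = (\<lambda>c z i. c * z i)"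
  "act (ones_obj m) = (\<lambda>z. 0)"
  by (auto simp: ones_obj_def coord_obj_def supported_def not_less)

lemma P_obj_sel [simp]:
  "carr (P_obj n) = supported {..<2 * n}" "scl (P_obj n) = (\<lambda>c z i. c * z i)"
  "act (P_obj n) = (\<lambda>z i. if i < 2 * n \<and> odd i then z (i - 1) else 0)"
  by (auto simp: P_obj_def coord_obj_def supported_def not_less)

lemma coordinate_obj_ones: "coordinate_obj (ones_obj m)"
  by (auto simp: coordinate_obj_def linear_on_def supported_def)

lemma coordinate_obj_P: "coordinate_obj (P_obj n)"
  by (auto simp: coordinate_obj_def linear_on_def supported_def fun_eq_iff)

abbreviation normal_obj :: "nat \<Rightarrow> nat \<Rightarrow> ('k::field, nat \<Rightarrow> 'k) obj" where
  "normal_obj m n \<equiv> sum_obj (ones_obj m) (P_obj n)"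

definition normal_support :: "nat \<Rightarrow> nat \<Rightarrow> nat set" where
  "normal_support m n = (\<lambda>i. 2 * i) ` {..<m} \<union> (\<lambda>i. 2 * i + 1) ` {..<2 * n}"

text \<open>\<open>t.w\<^sub>j\<close> has index \<open>2j + 1\<close> in \<open>nP\<close>, hence index \<open>2 (2j + 1) + 1\<close> after interleaving.\<close>

definition image_support :: "nat \<Rightarrow> nat set" where
  "image_support n = (\<lambda>j. 4 * j + 3) ` {..<n}"

lemma card_supports:
  "finite (normal_support m n)" "card (normal_support m n) = m + 2 * n"
  "finite (image_support n)" "card (image_support n) = n"
proof -
  have "(\<lambda>i::nat. 2 * i) ` {..<m} \<inter> (\<lambda>i. 2 * i + 1) ` {..<2 * n} = {}"
    by (auto, presburger)
  then show "card (normal_support m n) = m + 2 * n"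
    unfolding normal_support_def by (subst card_Un_disjoint) (auto simp: card_image inj_on_def)
qed (auto simp: normal_support_def image_support_def card_image inj_on_def)

lemma carr_normal_obj: "carr (normal_obj m n) = supported (normal_support m n)"
proof -
  have parity: "(\<forall>k. Q k) \<longleftrightarrow> (\<forall>i. Q (2 * i)) \<and> (\<forall>i. Q (2 * i + 1))" for Q :: "nat \<Rightarrow> bool"
    by (metis evenE oddE)
  have "2 * i \<in> normal_support m n \<longleftrightarrow> i < m" "2 * i + 1 \<in> normal_support m n \<longleftrightarrow> i < 2 * n" for i
    by (auto simp: normal_support_def, presburger+)
  then show ?thesis
    unfolding sum_obj_sel ones_obj_sel P_obj_sel supported_def evens_def odds_def
      parity[of "\<lambda>k. k \<notin> normal_support m n \<longrightarrow> _ k"]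
    by auto
qed

lemma image_normal_obj:
  "act (normal_obj m n) ` carr (normal_obj m n) = (supported (image_support n) :: (nat \<Rightarrow> 'k::field) set)"
proof (intro set_eqI iffI)
  fix z :: "nat \<Rightarrow> 'k"
  assume "z \<in> act (normal_obj m n) ` carr (normal_obj m n)"
  then obtain y :: "nat \<Rightarrow> 'k" where y: "z = act (normal_obj m n) y" by auto
  have "z i = 0" if "i \<notin> image_support n" for i
  proof (rule ccontr)
    assume "z i \<noteq> 0"
    then have "odd i" "odd (i div 2)" "i div 2 < 2 * n"
      by (auto simp: y join_def split: if_splits)
    \<comment> \<open>The first parity selects the summand nP, the second one a coordinate along
      some t.w_j inside it; together they say that \<open>i\<close> is 3 modulo 4.\<close>
    then have "i = 4 * (i div 4) + 3" "i div 4 < n" by presburger+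
    then show False using that by (auto simp: image_support_def)
  qed
  then show "z \<in> supported (image_support n)" by (auto simp: supported_def)
next
  fix z :: "nat \<Rightarrow> 'k"
  assume z: "z \<in> supported (image_support n)"
  \<comment> \<open>A preimage under t: the coordinate of \<open>z\<close> along t.w_j is moved back
    to w_j, and the component in m1 is 0.\<close>
  define y where "y = join 0 (\<lambda>i. if even i then odds z (i + 1) else 0)"
  have div: "(4 * j + 3) div 2 = 2 * j + 1" for j :: nat
    by presburger
  have 0: "z i = 0" if "even i \<or> even (i div 2) \<or> \<not> i div 2 < 2 * n" for i
  proof -
    have "i \<notin> image_support n"
      using that by (auto simp: image_support_def div)
    then show ?thesis using z by (auto simp: supported_def)
  qed
  have "evens z = 0" by (auto simp: evens_def fun_eq_iff intro!: 0)
  moreover have "odds z i = 0" if "even i \<or> \<not> i < 2 * n" for i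
    using that by (auto simp: odds_def intro!: 0)
  ultimately have "evens z = 0" "odds z = act (P_obj n) (odds y)"
    by (auto simp: y_def fun_eq_iff)
  then have "z = act (normal_obj m n) y"
    by (simp add: join_eq_iff del: P_obj_sel)
  moreover have "odds y \<in> supported {..<2 * n}"
    using \<open>\<And>i. even i \<or> \<not> i < 2 * n \<Longrightarrow> odds z i = 0\<close>
    by (auto simp: y_def supported_def)
  then have "y \<in> carr (normal_obj m n)"
    by (simp add: y_def supported_def)
  ultimately show "z \<in> act (normal_obj m n) ` carr (normal_obj m n)" by blast
qed

lemma scl_normal_obj: "scl (normal_obj m n) = (\<lambda>c z i. c * z i)"
  by (intro coordinate_objD(1) coordinate_obj_sum coordinate_obj_ones coordinate_obj_P)

text \<open>An isomorphism commutes with t, so it also restricts to an injective linear map between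
  the images of t. Each inequality is one of the two dimension bounds.\<close>

lemma normal_obj_le:
  assumes "isomorphic_obj (normal_obj m n :: ('k::field, nat \<Rightarrow> 'k) obj) (normal_obj m' n')"
  shows "m + 2 * n \<le> m' + 2 * n'" "n \<le> n'"
proof -
  let ?U = "normal_obj m n :: ('k, nat \<Rightarrow> 'k) obj" and ?V = "normal_obj m' n' :: ('k, nat \<Rightarrow> 'k) obj"
  obtain f where iso: "isomorphism ?U ?V f"
    using assms by (auto simp: isomorphic_obj_def)
  then have f: "morphism ?U ?V f" and inj: "inj_on f (carr ?U)"
    by (simp add: isomorphism_def, metis isomorphism_inj_on)
  then have lin: "linear_on ?U ?V f" by (simp add: morphism_def)
  from linear_inj_card_le[OF lin inj scl_normal_obj scl_normal_obj card_supports(1) carr_normal_obj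
      card_supports(1) carr_normal_obj]
  show "m + 2 * n \<le> m' + 2 * n'" by (simp add: card_supports)
  \<comment> \<open>The image of t as a space in its own right, so that the dimension bound applies
    to the restriction of \<open>f\<close>.\<close>
  let ?I = "\<lambda>k. \<lparr>carr = supported (image_support k), scl = (\<lambda>c z i. c * z i), act = id\<rparr> :: ('k, nat \<Rightarrow> 'k) obj"
  have U: "act ?U u \<in> carr ?U" if "u \<in> carr ?U" for u
    using that by (intro coordinate_objD(6) coordinate_obj_sum coordinate_obj_ones coordinate_obj_P)
  have sub: "supported (image_support n) \<subseteq> carr ?U"
    unfolding image_normal_obj[of m n, symmetric] using U by blast
  have img: "f z \<in> supported (image_support n')" if z: "z \<in> supported (image_support n)" for z
  proof -
    obtain u where u: "u \<in> carr ?U" "z = act ?U u"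
      using z unfolding image_normal_obj[of m n, symmetric] by blast
    have "f z = act ?V (f u)" using morphismD(4)[OF f u(1)] u(2) by simp
    then show ?thesis
      unfolding image_normal_obj[of m' n', symmetric] using morphismD(1)[OF f u(1)] by blast
  qed
  have "linear_on (?I n) (?I n') f"
    using img linear_onD(2)[OF lin] linear_onD(3)[OF lin, unfolded scl_normal_obj] sub
    unfolding linear_on_def by (simp add: subset_iff)
  moreover have "inj_on f (carr (?I n))"
    using inj sub by (simp add: inj_on_subset)
  ultimately have "card (image_support n) \<le> card (image_support n')"
    by (rule linear_inj_card_le) (auto simp: card_supports)
  then show "n \<le> n'" by (simp add: card_supports)
qed

lemma normal_obj_unique:
  assumes "isomorphic_obj (normal_obj m n :: ('k::field, nat \<Rightarrow> 'k) obj) (normal_obj m' n')"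
  shows "m = m' \<and> n = n'"
  using normal_obj_le[OF assms] normal_obj_le[OF isomorphic_obj_sym[OF assms]] by auto

section \<open>Well-behaved forms\<close>

lemma char2:
  fixes x y :: "'k::field"
  assumes "CHAR('k) = 2"
  shows add_self: "x + x = 0" and uminus_self: "- x = x" and diff_self: "x - y = x + y"
    and power2_add: "(x + y)\<^sup>2 = x\<^sup>2 + y\<^sup>2"
proof -
  have two: "(2 :: 'k) = 0" using of_nat_CHAR[where ?'a = 'k] assms by simp
  have *: "z + z = 0" for z :: 'k
    using mult_2[of z] by (simp only: two mult_zero_left)
  have **: "- z = z" for z :: 'k
    by (rule minus_unique[OF *])
  show "x + x = 0" "- x = x" by fact+
  show "x - y = x + y" by (simp only: diff_conv_add_uminus **)
  show "(x + y)\<^sup>2 = x\<^sup>2 + y\<^sup>2" by (simp add: power2_sum two)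
qed

abbreviation eval_form :: "('k::field, 'u::plus) bform \<Rightarrow> 'u \<Rightarrow> 'u \<Rightarrow> 'k" where
  "eval_form F u v \<equiv> snd F (pure_tensor (fst F) (fst F) u v)"

section \<open>Tensor products as spans of pure tensors\<close>

lemma tensor_obj_sel:
  "carr (tensor_obj U V) = fs.span {pure_tensor U V u v | u v. u \<in> carr U \<and> v \<in> carr V}"
  "scl (tensor_obj U V) = (\<lambda>c \<xi> b. c * \<xi> b)"
  by (auto simp: tensor_obj_def)

lemma pure_tensor_mem: "u \<in> carr U \<Longrightarrow> v \<in> carr V \<Longrightarrow> pure_tensor U V u v \<in> carr (tensor_obj U V)"
  unfolding tensor_obj_sel by (intro fs.span_base) blast

lemma tensor_closed:
  "\<xi> \<in> carr (tensor_obj U V) \<Longrightarrow> \<zeta> \<in> carr (tensor_obj U V) \<Longrightarrow> \<xi> + \<zeta> \<in> carr (tensor_obj U V)"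
  "\<xi> \<in> carr (tensor_obj U V) \<Longrightarrow> (\<lambda>b. c * \<xi> b) \<in> carr (tensor_obj U V)"
  "(\<lambda>_. 0) \<in> carr (tensor_obj U V)"
  "\<xi> \<in> carr (tensor_obj U V) \<Longrightarrow> \<zeta> \<in> carr (tensor_obj U V) \<Longrightarrow> (\<lambda>b. \<xi> b + \<zeta> b) \<in> carr (tensor_obj U V)"
proof -
  show add: "\<xi> + \<zeta> \<in> carr (tensor_obj U V)"
    if "\<xi> \<in> carr (tensor_obj U V)" "\<zeta> \<in> carr (tensor_obj U V)" for \<xi> \<zeta>
    using that unfolding tensor_obj_sel by (rule fs.span_add)
  show "(\<lambda>b. \<xi> b + \<zeta> b) \<in> carr (tensor_obj U V)"
    if "\<xi> \<in> carr (tensor_obj U V)" "\<zeta> \<in> carr (tensor_obj U V)" for \<xi> \<zeta>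
    using add[OF that] by (simp only: func_plus)
  show "(\<lambda>b. c * \<xi> b) \<in> carr (tensor_obj U V)" if "\<xi> \<in> carr (tensor_obj U V)"
    using that unfolding tensor_obj_sel by (rule fs.span_scale)
  show "(\<lambda>_. 0) \<in> carr (tensor_obj U V)"
    using fs.span_zero unfolding tensor_obj_sel func_zero .
qed

text \<open>Span induction that keeps membership in the carrier available, since forms are linear
  only there. Sums and multiples are written pointwise to match \<open>tensor_map\<close> and
  \<open>braiding\<close>.\<close>

lemma tensor_induct [consumes 1, case_names zero add scale pure]:
  assumes "\<xi> \<in> carr (tensor_obj U V)"
    and "Q (\<lambda>_. 0)"
    and "\<And>\<xi> \<zeta>. \<xi> \<in> carr (tensor_obj U V) \<Longrightarrow> \<zeta> \<in> carr (tensor_obj U V) \<Longrightarrow> Q \<xi> \<Longrightarrow> Q \<zeta> \<Longrightarrow> Q (\<lambda>b. \<xi> b + \<zeta> b)"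
    and "\<And>c \<xi>. \<xi> \<in> carr (tensor_obj U V) \<Longrightarrow> Q \<xi> \<Longrightarrow> Q (\<lambda>b. c * \<xi> b)"
    and "\<And>u v. u \<in> carr U \<Longrightarrow> v \<in> carr V \<Longrightarrow> Q (pure_tensor U V u v)"
  shows "Q \<xi>"
proof -
  let ?Q = "{\<xi> \<in> carr (tensor_obj U V). Q \<xi>}"
  have "fs.subspace ?Q"
    using assms(2-4) tensor_closed[where U = U and V = V]
    by (intro fs.subspaceI) (simp_all add: zero_fun_def plus_fun_def)
  moreover have "{pure_tensor U V u v | u v. u \<in> carr U \<and> v \<in> carr V} \<subseteq> ?Q"
    using assms(5) pure_tensor_mem by auto
  ultimately have "carr (tensor_obj U V) \<subseteq> ?Q"
    unfolding tensor_obj_sel(1)[of U V] by (rule fs.span_minimal[rotated])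
  then show ?thesis using assms(1) by auto
qed

lemma pure_tensor_add_left:
  "u \<in> carr U \<Longrightarrow> u' \<in> carr U \<Longrightarrow> v \<in> carr V \<Longrightarrow>
     pure_tensor U V (u + u') v = pure_tensor U V u v + pure_tensor U V u' v"
  by (auto simp: pure_tensor_def bilin_def linear_on_def unit_obj_def fun_eq_iff)

lemma pure_tensor_add_right:
  "u \<in> carr U \<Longrightarrow> v \<in> carr V \<Longrightarrow> v' \<in> carr V \<Longrightarrow>
     pure_tensor U V u (v + v') = pure_tensor U V u v + pure_tensor U V u v'"
  by (auto simp: pure_tensor_def bilin_def linear_on_def unit_obj_def fun_eq_iff)

lemma pure_tensor_scl_left:
  "u \<in> carr U \<Longrightarrow> v \<in> carr V \<Longrightarrow> pure_tensor U V (scl U c u) v = (\<lambda>b. c * pure_tensor U V u v b)"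
  by (auto simp: pure_tensor_def bilin_def linear_on_def unit_obj_def fun_eq_iff)

lemma pure_tensor_scl_right:
  "u \<in> carr U \<Longrightarrow> v \<in> carr V \<Longrightarrow> pure_tensor U V u (scl V c v) = (\<lambda>b. c * pure_tensor U V u v b)"
  by (auto simp: pure_tensor_def bilin_def linear_on_def unit_obj_def fun_eq_iff)

lemma tensor_map_mem:
  assumes "linear_on U U' f" "linear_on V V' g" "\<xi> \<in> carr (tensor_obj U V)"
  shows "tensor_map U' V' f g \<xi> \<in> carr (tensor_obj U' V')"
  using assms(3)
proof (induction rule: tensor_induct)
  case zero
  have "tensor_map U' V' f g (\<lambda>_. 0) = (\<lambda>_. 0)" by (auto simp: tensor_map_def)
  then show ?case by (simp add: tensor_closed)
next
  case (add \<xi> \<zeta>)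
  have "tensor_map U' V' f g (\<lambda>b. \<xi> b + \<zeta> b) =
      (\<lambda>b. tensor_map U' V' f g \<xi> b + tensor_map U' V' f g \<zeta> b)"
    by (auto simp: tensor_map_def)
  then show ?case using add by (simp add: tensor_closed)
next
  case (scale c \<xi>)
  have "tensor_map U' V' f g (\<lambda>b. c * \<xi> b) = (\<lambda>b. c * tensor_map U' V' f g \<xi> b)"
    by (auto simp: tensor_map_def)
  then show ?case using scale by (simp add: tensor_closed)
next
  case (pure u v)
  then show ?case
    using tensor_map_pure[OF assms(1,2)] linear_onD(1)[OF assms(1)] linear_onD(1)[OF assms(2)]
    by (simp add: pure_tensor_mem)
qed

text \<open>Symmetry is the ordinary one, without the braiding. The last two clauses are injectivity
  and surjectivity of the map to the dual; stating both spares a dimension count.\<close>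

definition good_form :: "('k::field, nat \<Rightarrow> 'k) bform \<Rightarrow> bool" where
  "good_form F \<longleftrightarrow>
     coordinate_obj (fst F) \<and>
     linear_on (tensor_obj (fst F) (fst F)) unit_obj (snd F) \<and>
     (\<forall>u\<in>carr (fst F). \<forall>v\<in>carr (fst F). eval_form F (act (fst F) u) v = eval_form F u (act (fst F) v)) \<and>
     (\<forall>u\<in>carr (fst F). \<forall>v\<in>carr (fst F). eval_form F u v = eval_form F v u) \<and>
     (\<forall>u\<in>carr (fst F). (\<forall>v\<in>carr (fst F). eval_form F u v = 0) \<longrightarrow> u = 0) \<and>
     (\<forall>f. linear_on (fst F) unit_obj f \<longrightarrow> (\<exists>u\<in>carr (fst F). \<forall>v\<in>carr (fst F). f v = eval_form F u v))"

lemma unit_obj_sel [simp]: "carr unit_obj = UNIV" "scl unit_obj = (*)" "act unit_obj = (\<lambda>_. 0)"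
  by (auto simp: unit_obj_def)

lemma good_formD:
  assumes "good_form F"
  shows "coordinate_obj (fst F)"
    and "linear_on (tensor_obj (fst F) (fst F)) unit_obj (snd F)"
    and "u \<in> carr (fst F) \<Longrightarrow> v \<in> carr (fst F) \<Longrightarrow>
           eval_form F (act (fst F) u) v = eval_form F u (act (fst F) v)"
    and "u \<in> carr (fst F) \<Longrightarrow> v \<in> carr (fst F) \<Longrightarrow> eval_form F u v = eval_form F v u"
    and "u \<in> carr (fst F) \<Longrightarrow> (\<And>v. v \<in> carr (fst F) \<Longrightarrow> eval_form F u v = 0) \<Longrightarrow> u = 0"
    and "linear_on (fst F) unit_obj f \<Longrightarrow>
           \<exists>u\<in>carr (fst F). \<forall>v\<in>carr (fst F). f v = eval_form F u v"
  using assms by (auto simp: good_form_def)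

lemma form_tensor_linear:
  assumes "good_form F"
  shows "\<xi> \<in> carr (tensor_obj (fst F) (fst F)) \<Longrightarrow> \<zeta> \<in> carr (tensor_obj (fst F) (fst F)) \<Longrightarrow>
           snd F (\<xi> + \<zeta>) = snd F \<xi> + snd F \<zeta>"
    and "\<xi> \<in> carr (tensor_obj (fst F) (fst F)) \<Longrightarrow> snd F (\<lambda>b. c * \<xi> b) = c * snd F \<xi>"
    and "snd F (\<lambda>_. 0) = 0"
    and "\<xi> \<in> carr (tensor_obj (fst F) (fst F)) \<Longrightarrow> \<zeta> \<in> carr (tensor_obj (fst F) (fst F)) \<Longrightarrow>
           snd F (\<lambda>b. \<xi> b + \<zeta> b) = snd F \<xi> + snd F \<zeta>"
proof -
  note lin = good_formD(2)[OF assms]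
  show "snd F (\<lambda>b. c * \<xi> b) = c * snd F \<xi>" if "\<xi> \<in> carr (tensor_obj (fst F) (fst F))"
    using linear_onD(3)[OF lin that, of c] by (simp add: tensor_obj_sel(2))
  show "snd F (\<lambda>_. 0) = 0"
    by (rule linear_on_zero[OF lin, unfolded func_zero, OF tensor_closed(3)])
  show add: "snd F (\<xi> + \<zeta>) = snd F \<xi> + snd F \<zeta>"
    if "\<xi> \<in> carr (tensor_obj (fst F) (fst F))" "\<zeta> \<in> carr (tensor_obj (fst F) (fst F))" for \<xi> \<zeta>
    by (rule linear_onD(2)[OF lin that])
  show "snd F (\<lambda>b. \<xi> b + \<zeta> b) = snd F \<xi> + snd F \<zeta>"
    if "\<xi> \<in> carr (tensor_obj (fst F) (fst F))" "\<zeta> \<in> carr (tensor_obj (fst F) (fst F))" for \<xi> \<zeta>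
    using add[OF that] by (simp only: func_plus)
qed

lemma eval_form_linear:
  assumes "good_form F" "u \<in> carr (fst F)" "v \<in> carr (fst F)"
  shows "w \<in> carr (fst F) \<Longrightarrow> eval_form F (u + w) v = eval_form F u v + eval_form F w v"
    and "w \<in> carr (fst F) \<Longrightarrow> eval_form F u (v + w) = eval_form F u v + eval_form F u w"
    and "eval_form F (scl (fst F) c u) v = c * eval_form F u v"
    and "eval_form F u (scl (fst F) c v) = c * eval_form F u v"
  using assms(2-)
  by (simp_all add: pure_tensor_add_left pure_tensor_add_right pure_tensor_scl_left
      pure_tensor_scl_right form_tensor_linear(1,2)[OF assms(1)] pure_tensor_mem)

lemma eval_form_zero:
  assumes "good_form F" "u \<in> carr (fst F)"
  shows "eval_form F 0 u = 0" "eval_form F u 0 = 0"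
proof -
  have 0: "0 \<in> carr (fst F)" by (intro coordinate_objD(3) good_formD(1) assms(1))
  have "eval_form F 0 u + eval_form F 0 u = eval_form F 0 u"
    using eval_form_linear(1)[OF assms(1) 0 assms(2) 0] by (simp only: add_0_left)
  then show "eval_form F 0 u = 0" by (simp only: add_cancel_left_left)
  have "eval_form F u 0 + eval_form F u 0 = eval_form F u 0"
    using eval_form_linear(2)[OF assms 0 0] by (simp only: add_0_left)
  then show "eval_form F u 0 = 0" by (simp only: add_cancel_left_left)
qed

text \<open>A morphism to the unit must kill t.(u \<otimes> v), that is, \<beta>(t.u, v) +
  \<beta>(u, t.v) = 0. In characteristic 2 this is the adjointness clause. The induction carries
  \<open>act ?T \<xi> \<in> carr ?T\<close> along because the form is linear on the carrier
  only.\<close>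

lemma good_form_bilinear:
  fixes F :: "('k::field, nat \<Rightarrow> 'k) bform"
  assumes "CHAR('k) = 2" "good_form F"
  shows "bilinear_form F"
proof -
  note good = good_formD[OF assms(2)] and obj = coordinate_objD[OF good_formD(1)[OF assms(2)]]
  let ?T = "tensor_obj (fst F) (fst F)"
  have "act ?T \<xi> \<in> carr ?T \<and> snd F (act ?T \<xi>) = 0" if "\<xi> \<in> carr ?T" for \<xi>
    using that
  proof (induction rule: tensor_induct)
    case zero
    have "act ?T (\<lambda>_. 0) = (\<lambda>_. 0)" by (auto simp: tensor_obj_def)
    then show ?case by (simp add: tensor_closed form_tensor_linear[OF assms(2)])
  next
    case (add \<xi> \<zeta>)
    have "act ?T (\<lambda>b. \<xi> b + \<zeta> b) = (\<lambda>b. act ?T \<xi> b + act ?T \<zeta> b)"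
      by (auto simp: tensor_obj_def)
    then show ?case using add by (simp add: tensor_closed form_tensor_linear[OF assms(2)])
  next
    case (scale c \<xi>)
    have "act ?T (\<lambda>b. c * \<xi> b) = (\<lambda>b. c * act ?T \<xi> b)" by (auto simp: tensor_obj_def algebra_simps)
    then show ?case using scale by (simp add: tensor_closed form_tensor_linear[OF assms(2)])
  next
    case (pure u v)
    let ?tu = "pure_tensor (fst F) (fst F) (act (fst F) u) v"
      and ?tv = "pure_tensor (fst F) (fst F) u (act (fst F) v)"
    have mem: "?tu \<in> carr ?T" "?tv \<in> carr ?T"
      using pure by (auto intro!: pure_tensor_mem obj(6))
    have "snd F (?tu + ?tv) = 0"
      unfolding form_tensor_linear(1)[OF assms(2) mem] good(3)[OF pure] by (rule add_self[OF assms(1)])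
    then show ?case
      unfolding tensor_obj_act_pure[OF obj(2) obj(2) pure] using tensor_closed(1)[OF mem] by blast
  qed
  then show ?thesis
    using good(2) is_object_coordinate[OF good(1)]
    by (auto simp: bilinear_form_def morphism_def split_beta)
qed

text \<open>The extra term of the braiding contributes \<beta>(t.v, t.u) = \<beta>(v, t.t.u) = 0, so
  ordinary symmetry suffices.\<close>

lemma good_form_symmetric:
  fixes F :: "('k::field, nat \<Rightarrow> 'k) bform"
  assumes "good_form F"
  shows "symmetric_form F"
proof -
  note good = good_formD[OF assms] and obj = coordinate_objD[OF good_formD(1)[OF assms]]
  let ?T = "tensor_obj (fst F) (fst F)" and ?c = "braiding (fst F) (fst F)"
  have "?c \<xi> \<in> carr ?T \<and> snd F (?c \<xi>) = snd F \<xi>" if "\<xi> \<in> carr ?T" for \<xi>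
    using that
  proof (induction rule: tensor_induct)
    case zero
    have "?c (\<lambda>_. 0) = (\<lambda>_. 0)" by (auto simp: braiding_def)
    then show ?case by (simp add: tensor_closed)
  next
    case (add \<xi> \<zeta>)
    have "?c (\<lambda>b. \<xi> b + \<zeta> b) = (\<lambda>b. ?c \<xi> b + ?c \<zeta> b)" by (auto simp: braiding_def)
    then show ?case using add by (simp add: tensor_closed form_tensor_linear[OF assms])
  next
    case (scale c \<xi>)
    have "?c (\<lambda>b. c * \<xi> b) = (\<lambda>b. c * ?c \<xi> b)" by (auto simp: braiding_def)
    then show ?case using scale by (simp add: tensor_closed form_tensor_linear[OF assms])
  next
    case (pure u v)
    let ?vu = "pure_tensor (fst F) (fst F) v u"
      and ?tt = "pure_tensor (fst F) (fst F) (act (fst F) v) (act (fst F) u)"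
    have mem: "?vu \<in> carr ?T" "?tt \<in> carr ?T"
      using pure by (auto intro!: pure_tensor_mem obj(6))
    have "snd F ?tt = 0"
      unfolding good(3)[OF pure(2) obj(6)[OF pure(1)]] obj(8)[OF pure(1)]
      by (rule eval_form_zero(2)[OF assms pure(2)])
    then have "snd F (?vu + ?tt) = eval_form F u v"
      unfolding form_tensor_linear(1)[OF assms mem] good(4)[OF pure] by (simp only: add_0_right)
    then show ?case
      unfolding braiding_pure[OF obj(2) obj(2) pure] using tensor_closed(1)[OF mem] by blast
  qed
  then show ?thesis by (auto simp: symmetric_form_def split_beta)
qed

text \<open>Adjointness makes the map to the dual commute with t, as t acts there by
  precomposition.\<close>

lemma good_form_nondegenerate:
  fixes F :: "('k::field, nat \<Rightarrow> 'k) bform"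
  assumes "good_form F"
  shows "nondegenerate_form F"
proof -
  note good = good_formD[OF assms] and obj = coordinate_objD[OF good_formD(1)[OF assms]]
    and lin = eval_form_linear[OF assms]
  let ?U = "fst F"
  let ?f = "\<lambda>u u'. if u' \<in> carr ?U then eval_form F u u' else 0"
  have lin_f: "linear_on ?U unit_obj (?f u)" if "u \<in> carr ?U" for u
    unfolding linear_on_def using that by (simp add: lin obj(4,5))
  have mor: "morphism ?U (dual_obj ?U) ?f"
    using lin_f unfolding morphism_def linear_on_def[of ?U "dual_obj ?U"]
    by (auto simp: dual_obj_def lin fun_eq_iff obj(6) good(3))
  have "inj_on ?f (carr ?U)"
  proof (rule inj_onI)
    fix u v assume uv: "u \<in> carr ?U" "v \<in> carr ?U" "?f u = ?f v"
    \<comment> \<open>This is \<open>- v\<close>, written as a scalar multiple so that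
      \<open>lin\<close> applies.\<close>
    let ?v = "scl ?U (- 1) v"
    have v: "?v \<in> carr ?U" using uv by (intro obj)
    have "u + ?v = 0"
    proof (rule good(5))
      show "u + ?v \<in> carr ?U" using uv v by (intro obj)
      fix w assume w: "w \<in> carr ?U"
      then have "eval_form F u w = eval_form F v w" using fun_cong[OF uv(3), of w] by simp
      then show "eval_form F (u + ?v) w = 0"
        using uv v w by (simp add: lin)
    qed
    moreover have "?v = - v" by (auto simp: obj(1))
    ultimately show "u = v" by simp
  qed
  moreover have "?f ` carr ?U = carr (dual_obj ?U)"
  proof
    show "?f ` carr ?U \<subseteq> carr (dual_obj ?U)"
      using morphismD(1)[OF mor] by auto
    show "carr (dual_obj ?U) \<subseteq> ?f ` carr ?U"
    proof
      fix g assume "g \<in> carr (dual_obj ?U)"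
      then have g: "linear_on ?U unit_obj g" "\<And>u. u \<notin> carr ?U \<Longrightarrow> g u = 0"
        by (auto simp: dual_obj_def)
      from good(6)[OF g(1)] obtain u where "u \<in> carr ?U" "\<forall>v\<in>carr ?U. g v = eval_form F u v" by auto
      then show "g \<in> ?f ` carr ?U" using g(2) by (intro image_eqI[of _ _ u]) auto
    qed
  qed
  ultimately have "bij_betw ?f (carr ?U) (carr (dual_obj ?U))" by (simp add: bij_betw_def)
  then have "isomorphism ?U (dual_obj ?U) ?f"
    by (intro isomorphism_if_bij_betw mor obj)
  then show ?thesis by (simp add: nondegenerate_form_def split_beta)
qed

section \<open>Orthogonal sums\<close>

lemma linear_on_evens: "linear_on (sum_obj U V) U evens"
  and linear_on_odds: "linear_on (sum_obj U V) V odds"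
  by (simp_all add: linear_on_def)

lemma eval_form_sum:
  assumes "u \<in> carr (sum_obj (fst F) (fst G))" "v \<in> carr (sum_obj (fst F) (fst G))"
  shows "eval_form (F \<oplus>\<^sub>f G) u v = eval_form F (evens u) (evens v) + eval_form G (odds u) (odds v)"
  unfolding sum_form_def fst_conv snd_conv
  by (simp only: tensor_map_pure[OF linear_on_evens linear_on_evens assms]
      tensor_map_pure[OF linear_on_odds linear_on_odds assms])

lemma fst_sum_form [simp]: "fst (F \<oplus>\<^sub>f G) = sum_obj (fst F) (fst G)"
  by (simp add: sum_form_def)

lemma join_zero_mem:
  assumes "good_form F" "good_form G"
  shows "u \<in> carr (fst F) \<Longrightarrow> join u 0 \<in> carr (sum_obj (fst F) (fst G))"
    and "v \<in> carr (fst G) \<Longrightarrow> join 0 v \<in> carr (sum_obj (fst F) (fst G))"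
  using coordinate_objD(3)[OF good_formD(1)[OF assms(1)]]
    coordinate_objD(3)[OF good_formD(1)[OF assms(2)]] by auto

lemma eval_form_join_zero:
  assumes "good_form F" "good_form G" "w \<in> carr (sum_obj (fst F) (fst G))"
  shows "u \<in> carr (fst F) \<Longrightarrow> eval_form (F \<oplus>\<^sub>f G) (join u 0) w = eval_form F u (evens w)"
    and "v \<in> carr (fst G) \<Longrightarrow> eval_form (F \<oplus>\<^sub>f G) (join 0 v) w = eval_form G v (odds w)"
proof -
  have w: "evens w \<in> carr (fst F)" "odds w \<in> carr (fst G)" using assms(3) by auto
  show "eval_form (F \<oplus>\<^sub>f G) (join u 0) w = eval_form F u (evens w)" if "u \<in> carr (fst F)"
    unfolding eval_form_sum[OF join_zero_mem(1)[OF assms(1,2) that] assms(3)] evens_join odds_join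
      eval_form_zero(1)[OF assms(2) w(2)] by (rule add_0_right)
  show "eval_form (F \<oplus>\<^sub>f G) (join 0 v) w = eval_form G v (odds w)" if "v \<in> carr (fst G)"
    unfolding eval_form_sum[OF join_zero_mem(2)[OF assms(1,2) that] assms(3)] evens_join odds_join
      eval_form_zero(1)[OF assms(1) w(1)] by (rule add_0_left)
qed

text \<open>Vanishing is tested against the embedded vectors \<open>join v 0\<close> and
  \<open>join 0 v\<close>. A functional on the sum is represented by joining the vectors that
  represent its two restrictions.\<close>

lemma good_form_sum:
  assumes F: "good_form F" and G: "good_form G"
  shows "good_form (F \<oplus>\<^sub>f G)"
proof -
  note goodF = good_formD[OF F] and goodG = good_formD[OF G]
  note objF = coordinate_objD[OF goodF(1)] and objG = coordinate_objD[OF goodG(1)]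
  let ?S = "sum_obj (fst F) (fst G)"
  let ?T = "tensor_obj ?S ?S"
  let ?e = "tensor_map (fst F) (fst F) evens evens" and ?o = "tensor_map (fst G) (fst G) odds odds"
  have S: "coordinate_obj ?S" by (rule coordinate_obj_sum[OF goodF(1) goodG(1)])
  have e: "?e \<xi> \<in> carr (tensor_obj (fst F) (fst F))" if "\<xi> \<in> carr ?T" for \<xi>
    by (rule tensor_map_mem[OF linear_on_evens linear_on_evens that])
  have o: "?o \<xi> \<in> carr (tensor_obj (fst G) (fst G))" if "\<xi> \<in> carr ?T" for \<xi>
    by (rule tensor_map_mem[OF linear_on_odds linear_on_odds that])
  have "linear_on ?T unit_obj (snd (F \<oplus>\<^sub>f G))"
    unfolding linear_on_def
  proof (intro conjI ballI allI)
    fix \<xi> \<zeta> assume *: "\<xi> \<in> carr ?T" "\<zeta> \<in> carr ?T"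
    have "?e (\<xi> + \<zeta>) = ?e \<xi> + ?e \<zeta>" "?o (\<xi> + \<zeta>) = ?o \<xi> + ?o \<zeta>"
      by (auto simp: tensor_map_def)
    then show "snd (F \<oplus>\<^sub>f G) (\<xi> + \<zeta>) = snd (F \<oplus>\<^sub>f G) \<xi> + snd (F \<oplus>\<^sub>f G) \<zeta>"
      using form_tensor_linear(1)[OF F e e, OF *] form_tensor_linear(1)[OF G o o, OF *]
      by (simp add: sum_form_def)
  next
    fix c \<xi> assume *: "\<xi> \<in> carr ?T"
    have "?e (\<lambda>b. c * \<xi> b) = (\<lambda>b. c * ?e \<xi> b)" "?o (\<lambda>b. c * \<xi> b) = (\<lambda>b. c * ?o \<xi> b)"
      by (auto simp: tensor_map_def)
    then show "snd (F \<oplus>\<^sub>f G) (scl ?T c \<xi>) = scl unit_obj c (snd (F \<oplus>\<^sub>f G) \<xi>)"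
      using form_tensor_linear(2)[OF F e, OF *] form_tensor_linear(2)[OF G o, OF *]
      by (simp add: sum_form_def tensor_obj_sel(2) distrib_left)
  qed simp
  moreover have "eval_form (F \<oplus>\<^sub>f G) (act ?S u) v = eval_form (F \<oplus>\<^sub>f G) u (act ?S v)"
    if uv: "u \<in> carr ?S" "v \<in> carr ?S" for u v
    using uv goodF(3) goodG(3)
    unfolding eval_form_sum[OF coordinate_objD(6)[OF S uv(1)] uv(2)]
      eval_form_sum[OF uv(1) coordinate_objD(6)[OF S uv(2)]] by simp
  moreover have "eval_form (F \<oplus>\<^sub>f G) u v = eval_form (F \<oplus>\<^sub>f G) v u"
    if uv: "u \<in> carr ?S" "v \<in> carr ?S" for u v
    using uv goodF(4)[of "evens u" "evens v"] goodG(4)[of "odds u" "odds v"]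
    unfolding eval_form_sum[OF uv] eval_form_sum[OF uv(2,1)] by simp
  moreover have "u = 0"
    if u: "u \<in> carr ?S" and 0: "\<forall>v\<in>carr ?S. eval_form (F \<oplus>\<^sub>f G) u v = 0" for u
  proof -
    have mem: "evens u \<in> carr (fst F)" "odds u \<in> carr (fst G)" using u by auto
    have "evens u = 0"
    proof (rule goodF(5)[OF mem(1)])
      fix v assume v: "v \<in> carr (fst F)"
      note jv = join_zero_mem(1)[OF F G v]
      show "eval_form F (evens u) v = 0"
        using bspec[OF 0 jv] eval_form_zero(2)[OF G mem(2)]
        unfolding eval_form_sum[OF u jv] evens_join odds_join by simp
    qed
    moreover have "odds u = 0"
    proof (rule goodG(5)[OF mem(2)])
      fix v assume v: "v \<in> carr (fst G)"
      note jv = join_zero_mem(2)[OF F G v]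
      show "eval_form G (odds u) v = 0"
        using bspec[OF 0 jv] eval_form_zero(2)[OF F mem(1)]
        unfolding eval_form_sum[OF u jv] evens_join odds_join by simp
    qed
    ultimately show "u = 0" by (metis join_evens_odds join_zero)
  qed
  moreover have "\<exists>u\<in>carr ?S. \<forall>v\<in>carr ?S. f v = eval_form (F \<oplus>\<^sub>f G) u v"
    if f: "linear_on ?S unit_obj f" for f
  proof -
    have "linear_on (fst F) unit_obj (\<lambda>x. f (join x 0))"
      unfolding linear_on_def
    proof (intro conjI ballI allI)
      fix x y assume "x \<in> carr (fst F)" "y \<in> carr (fst F)"
      from linear_onD(2)[OF f join_zero_mem(1)[OF F G this(1)] join_zero_mem(1)[OF F G this(2)]]
      show "f (join (x + y) 0) = f (join x 0) + f (join y 0)"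
        by (simp only: join_add[symmetric] add_0_left)
    next
      fix c x assume "x \<in> carr (fst F)"
      from linear_onD(3)[OF f join_zero_mem(1)[OF F G this], of c]
      show "f (join (scl (fst F) c x) 0) = scl unit_obj c (f (join x 0))"
        by (simp add: objG(1) flip: func_zero)
    qed simp
    from goodF(6)[OF this] obtain a where a: "a \<in> carr (fst F)"
      "\<And>v. v \<in> carr (fst F) \<Longrightarrow> f (join v 0) = eval_form F a v" by auto
    have "linear_on (fst G) unit_obj (\<lambda>x. f (join 0 x))"
      unfolding linear_on_def
    proof (intro conjI ballI allI)
      fix x y assume "x \<in> carr (fst G)" "y \<in> carr (fst G)"
      from linear_onD(2)[OF f join_zero_mem(2)[OF F G this(1)] join_zero_mem(2)[OF F G this(2)]]
      show "f (join 0 (x + y)) = f (join 0 x) + f (join 0 y)"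
        by (simp only: join_add[symmetric] add_0_left)
    next
      fix c x assume "x \<in> carr (fst G)"
      from linear_onD(3)[OF f join_zero_mem(2)[OF F G this], of c]
      show "f (join 0 (scl (fst G) c x)) = scl unit_obj c (f (join 0 x))"
        by (simp add: objF(1) flip: func_zero)
    qed simp
    from goodG(6)[OF this] obtain b where b: "b \<in> carr (fst G)"
      "\<And>v. v \<in> carr (fst G) \<Longrightarrow> f (join 0 v) = eval_form G b v" by auto
    have ab: "join a b \<in> carr ?S" using a b by simp
    have "f v = eval_form (F \<oplus>\<^sub>f G) (join a b) v" if v: "v \<in> carr ?S" for v
    proof -
      have mem: "evens v \<in> carr (fst F)" "odds v \<in> carr (fst G)" using v by auto
      have "v = join (evens v) 0 + join 0 (odds v)"
        by (simp only: join_add[symmetric] add_0_left add_0_right join_evens_odds)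
      then have "f v = f (join (evens v) 0) + f (join 0 (odds v))"
        using linear_onD(2)[OF f join_zero_mem(1)[OF F G mem(1)] join_zero_mem(2)[OF F G mem(2)]]
        by simp
      then show ?thesis
        unfolding eval_form_sum[OF ab v] evens_join odds_join using a(2)[OF mem(1)] b(2)[OF mem(2)] by simp
    qed
    then show ?thesis using ab by blast
  qed
  ultimately show ?thesis
    unfolding good_form_def fst_sum_form using S by blast
qed

lemma fst_zero_form [simp]: "fst zero_form = ones_obj 0"
  by (simp add: zero_form_def)

lemma good_form_zero: "good_form zero_form"
proof -
  have 0: "v \<in> carr (ones_obj 0) \<longleftrightarrow> v = 0" for v :: "nat \<Rightarrow> 'a"
    by (auto simp: supported_def)
  have "f 0 = 0" if "linear_on (ones_obj 0 :: ('a, nat \<Rightarrow> 'a) obj) unit_obj f" for f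
    using linear_on_zero[OF that] 0 by blast
  then show ?thesis
    unfolding good_form_def zero_form_def fst_conv snd_conv
    by (auto simp: coordinate_obj_ones linear_on_def 0 simp del: ones_obj_sel(1))
qed

lemma good_form_copies: "good_form F \<Longrightarrow> good_form (copies k F)"
  by (induction k) (simp_all add: good_form_zero good_form_sum)

section \<open>Forms given by a Gram matrix\<close>

definition gram :: "nat \<Rightarrow> (nat \<Rightarrow> nat \<Rightarrow> 'k::field) \<Rightarrow> (nat \<Rightarrow> 'k) \<Rightarrow> (nat \<Rightarrow> 'k) \<Rightarrow> 'k" where
  "gram d G u v = (\<Sum>i<d. \<Sum>j<d. u i * G i j * v j)"

lemma fst_gram_form [simp]: "fst (gram_form d U G) = U"
  by (simp add: gram_form_def)

text \<open>A pure tensor is 0 outside \<open>bilin\<close>, so the Gram pairing must be shown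
  bilinear before the form can be evaluated.\<close>

lemma eval_form_gram:
  assumes "coordinate_obj U" "u \<in> carr U" "v \<in> carr U"
  shows "eval_form (gram_form d U G) u v = gram d G u v"
proof -
  have "gram d G \<in> bilin U U"
    by (auto simp: bilin_def linear_on_def gram_def coordinate_objD(1)[OF assms(1)] algebra_simps
        sum.distrib sum_distrib_left)
  then show ?thesis
    by (simp add: gram_form_def pure_tensor_def gram_def[abs_def])
qed

text \<open>\<open>H\<close> is a right inverse of \<open>G\<close>. Pairing with its k-th column
  extracts the coordinate u_k, which gives injectivity; applying it to the values of a functional on
  unit vectors gives the representing vector.\<close>

lemma good_form_gram:
  fixes G H :: "nat \<Rightarrow> nat \<Rightarrow> 'k::field"
  assumes U: "coordinate_obj U" "carr U = supported {..<d}"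
    and sym: "\<And>i j. i < d \<Longrightarrow> j < d \<Longrightarrow> G i j = G j i"
    and inv: "\<And>i k. i < d \<Longrightarrow> k < d \<Longrightarrow> (\<Sum>j<d. G i j * H j k) = (if i = k then 1 else 0)"
    and adj: "\<And>u v. u \<in> carr U \<Longrightarrow> v \<in> carr U \<Longrightarrow> gram d G (act U u) v = gram d G u (act U v)"
  shows "good_form (gram_form d U G)"
proof -
  have flip: "gram d G u v = gram d G v u" for u v
    unfolding gram_def
    by (subst sum.swap) (auto intro!: sum.cong simp: sym)
  have inj: "u = 0" if u: "u \<in> carr U" and 0: "\<forall>v\<in>carr U. gram d G u v = 0" for u
  proof
    fix k
    show "u k = 0 k"
    proof (cases "k < d")
      case True
      let ?v = "\<lambda>j. if j < d then H j k else 0"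
      have "gram d G u ?v = (\<Sum>i<d. u i * (\<Sum>j<d. G i j * H j k))"
        unfolding gram_def by (auto simp: sum_distrib_left mult.assoc intro!: sum.cong)
      also have "\<dots> = (\<Sum>i<d. if i = k then u i else 0)"
        by (intro sum.cong) (auto simp: inv True)
      also have "\<dots> = u k" using True by simp
      finally show ?thesis using 0 by (simp add: U(2) supported_def)
    next
      case False
      then show ?thesis using u by (simp add: U(2) supported_def)
    qed
  qed
  have surj: "\<exists>u\<in>carr U. \<forall>v\<in>carr U. f v = gram d G u v" if f: "linear_on U unit_obj f" for f
  proof (intro bexI ballI)
    let ?u = "\<lambda>i. if i < d then \<Sum>k<d. H i k * f (unit_vec k) else 0"
    show "?u \<in> carr U" by (simp add: U(2) supported_def)
    fix v assume v: "v \<in> carr U"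
    \<comment> \<open>Swapping the arguments brings \<open>G\<close> next to \<open>H\<close>, in
      the order in which \<open>inv\<close> gives the identity matrix.\<close>
    have "gram d G ?u v = gram d G v ?u" by (rule flip)
    also have "\<dots> = (\<Sum>j<d. v j * (\<Sum>i<d. \<Sum>k<d. G j i * H i k * f (unit_vec k)))"
      unfolding gram_def by (auto simp: sum_distrib_left mult.assoc intro!: sum.cong)
    also have "\<dots> = (\<Sum>j<d. v j * (\<Sum>k<d. (\<Sum>i<d. G j i * H i k) * f (unit_vec k)))"
      by (rule sum.cong[OF refl], rule arg_cong[of _ _ "(*) _"], subst sum.swap)
        (simp add: sum_distrib_right)
    also have "\<dots> = (\<Sum>j<d. v j * (\<Sum>k<d. if j = k then f (unit_vec k) else 0))"
      by (intro sum.cong refl arg_cong2[of _ _ _ _ "(*)"]) (simp add: inv)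
    also have "\<dots> = (\<Sum>j<d. v j * f (unit_vec j))"
      by (intro sum.cong) auto
    also have "\<dots> = f v"
      using linear_on_expansion[OF f coordinate_objD(1)[OF U(1)], of "{..<d}" v] U(2) v by simp
    finally show "f v = gram d G ?u v" ..
  qed
  have lin: "linear_on (tensor_obj U U) unit_obj (snd (gram_form d U G))"
    by (simp add: linear_on_def gram_form_def tensor_obj_sel(2))
  have eval: "snd (gram_form d U G) (pure_tensor U U u v) = gram d G u v"
    if "u \<in> carr U" "v \<in> carr U" for u v
    using eval_form_gram[OF U(1) that] by simp
  show ?thesis
    unfolding good_form_def fst_gram_form
  proof (intro conjI ballI allI impI)
    fix u v assume "u \<in> carr U" "v \<in> carr U"
    then show "snd (gram_form d U G) (pure_tensor U U (act U u) v) =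
        snd (gram_form d U G) (pure_tensor U U u (act U v))"
      using adj coordinate_objD(6)[OF U(1)] by (simp add: eval)
    show "snd (gram_form d U G) (pure_tensor U U u v) = snd (gram_form d U G) (pure_tensor U U v u)"
      using \<open>u \<in> carr U\<close> \<open>v \<in> carr U\<close> flip[of u v] by (simp add: eval)
  next
    fix u assume "u \<in> carr U" "\<forall>v\<in>carr U. snd (gram_form d U G) (pure_tensor U U u v) = 0"
    then show "u = 0" using inj by (simp add: eval)
  next
    fix f assume "linear_on U unit_obj f"
    then show "\<exists>u\<in>carr U. \<forall>v\<in>carr U. f v = snd (gram_form d U G) (pure_tensor U U u v)"
      using surj by (simp add: eval)
  qed (use U(1) lin in simp_all)
qed

text \<open>Off-diagonal terms come in equal pairs. The induction splits off the last row and the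
  last column, whose contributions agree by symmetry and hence cancel.\<close>

lemma gram_alternating:
  fixes G :: "nat \<Rightarrow> nat \<Rightarrow> 'k::field"
  assumes "CHAR('k) = 2"
    and "\<And>i j. i < d \<Longrightarrow> j < d \<Longrightarrow> G i j = G j i" and "\<And>i. i < d \<Longrightarrow> G i i = 0"
  shows "gram d G u u = 0"
  using assms(2,3)
proof (induction d)
  case (Suc d)
  have "gram (Suc d) G u u =
      gram d G u u + ((\<Sum>i<d. u i * G i d * u d) + (\<Sum>j<d. u d * G d j * u j)) + u d * G d d * u d"
    by (simp add: gram_def sum.distrib algebra_simps)
  also have "(\<Sum>j<d. u d * G d j * u j) = (\<Sum>i<d. u i * G i d * u d)"
    by (intro sum.cong) (simp_all add: Suc.prems(1)[of d])
  also have "gram d G u u = 0" using Suc by simp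
  finally show ?case by (simp only: add_self[OF assms(1)] Suc.prems(2)[of d]) simp
qed (simp add: gram_def)

section \<open>The named forms as Gram forms\<close>

lemma sum_lessThan_2: "(\<Sum>i<2. f i) = f 0 + f (Suc 0)" for f :: "nat \<Rightarrow> 'a::comm_monoid_add"
  by (simp add: eval_nat_numeral)

lemma sum_lessThan_4: "(\<Sum>i<4. f i) = f 0 + f (Suc 0) + f 2 + f 3" for f :: "nat \<Rightarrow> 'a::comm_monoid_add"
  by (simp add: eval_nat_numeral)

lemma less_4_cases: "i < 4 \<Longrightarrow> i = 0 \<or> i = Suc 0 \<or> i = 2 \<or> i = (3 :: nat)"
  by auto

lemma fst_named_forms [simp]:
  "fst (alpha1 m) = ones_obj m" "fst (alpha2 m) = ones_obj m"
  "fst (beta_P y) = P_obj 1" "fst (beta_2P a) = P_obj 2"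
  by (simp_all add: alpha1_def alpha2_def beta_P_def beta_2P_def)

lemma gram_zero: "gram d G 0 v = 0" "gram d G v 0 = 0"
  by (simp_all add: gram_def)

lemma eval_alpha1:
  "u \<in> carr (ones_obj m) \<Longrightarrow> v \<in> carr (ones_obj m) \<Longrightarrow> eval_form (alpha1 m) u v = (\<Sum>i<m. u i * v i)"
  unfolding alpha1_def fst_gram_form
  by (simp add: eval_form_gram[OF coordinate_obj_ones, unfolded fst_gram_form] gram_def
      if_distrib[of "\<lambda>x. _ * x * _"] cong: if_cong)

lemma eval_beta_P:
  "u \<in> carr (P_obj 1) \<Longrightarrow> v \<in> carr (P_obj 1) \<Longrightarrow>
     eval_form (beta_P y) u v = y * u 0 * v 0 + u 0 * v 1 + u 1 * v 0"
  unfolding beta_P_def fst_gram_form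
  by (simp add: eval_form_gram[OF coordinate_obj_P, unfolded fst_gram_form] gram_def sum_lessThan_2)

lemma eval_beta_2P:
  "u \<in> carr (P_obj 2) \<Longrightarrow> v \<in> carr (P_obj 2) \<Longrightarrow>
     eval_form (beta_2P a) u v = a * u 0 * v 0 + u 0 * v 3 + u 1 * v 2 + u 2 * v 1 + u 3 * v 0"
  unfolding beta_2P_def fst_gram_form
  by (simp add: eval_form_gram[OF coordinate_obj_P, unfolded fst_gram_form] gram_def sum_lessThan_4)

lemma good_form_alpha1: "good_form (alpha1 m :: ('k::field, nat \<Rightarrow> 'k) bform)"
  unfolding alpha1_def
  by (rule good_form_gram[where H = "\<lambda>i j. if i = j then 1 else 0"])
    (auto simp: coordinate_obj_ones gram_zero if_distrib[of "\<lambda>x. x * _"] cong: if_cong)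

definition hyperbolic :: "nat \<Rightarrow> nat \<Rightarrow> 'k::field" where
  "hyperbolic i j = (if i div 2 = j div 2 then [[0, 1], [1, 0]] ! (i mod 2) ! (j mod 2) else 0)"

text \<open>The permutation matrix of the involution that swaps 2k and 2k + 1; hence it is symmetric
  and its own inverse.\<close>

lemma hyperbolic_eq: "hyperbolic i j = (if j = (if even i then i + 1 else i - 1) then 1 else 0)"
proof -
  have "i div 2 = j div 2 \<longleftrightarrow> j = 2 * (i div 2) \<or> j = 2 * (i div 2) + 1"
    by presburger
  then show ?thesis
    by (auto simp: hyperbolic_def elim!: evenE oddE)
qed

lemma hyperbolic_sym: "hyperbolic i j = hyperbolic j i"
  unfolding hyperbolic_eq by (auto elim!: evenE oddE)

lemma alpha2_eq: "alpha2 m = gram_form m (ones_obj m) hyperbolic"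
  by (simp add: alpha2_def hyperbolic_def[abs_def])

lemma good_form_alpha2:
  assumes "even m"
  shows "good_form (alpha2 m :: ('k::field, nat \<Rightarrow> 'k) bform)"
  unfolding alpha2_eq
proof (rule good_form_gram[where H = hyperbolic])
  fix i k assume "i < m" "k < m"
  let ?p = "\<lambda>i::nat. if even i then i + 1 else i - 1"
  \<comment> \<open>Evenness of \<open>m\<close> keeps the partner of every index below
    \<open>m\<close>.\<close>
  have "?p i < m" using \<open>i < m\<close> assms by (auto elim!: evenE oddE)
  have "(\<Sum>j<m. hyperbolic i j * hyperbolic j k :: 'k) = (\<Sum>j<m. if j = ?p i then hyperbolic j k else 0)"
    by (intro sum.cong refl) (simp add: hyperbolic_eq[of i])
  also have "\<dots> = hyperbolic (?p i) k"
    using \<open>?p i < m\<close> by (subst sum.delta) auto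
  also have "\<dots> = (if i = k then 1 else 0)"
    unfolding hyperbolic_eq by (auto elim!: evenE oddE)
  finally show "(\<Sum>j<m. hyperbolic i j * hyperbolic j k :: 'k) = (if i = k then 1 else 0)" .
qed (simp_all add: coordinate_obj_ones gram_zero hyperbolic_sym flip: func_zero)

lemma eval_alpha2:
  assumes "CHAR('k::field) = 2" "u \<in> carr (ones_obj m)"
  shows "eval_form (alpha2 m) u u = (0 :: 'k)"
  unfolding alpha2_eq eval_form_gram[OF coordinate_obj_ones assms(2) assms(2)]
  by (rule gram_alternating[OF assms(1) hyperbolic_sym]) (auto simp: hyperbolic_eq elim!: oddE)

lemma good_form_beta_P: "good_form (beta_P y :: ('k::field, nat \<Rightarrow> 'k) bform)"
  unfolding beta_P_def
  by (rule good_form_gram[where H = "\<lambda>i j. [[0, 1], [1, - y]] ! i ! j"])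
    (auto simp: coordinate_obj_P gram_def sum_lessThan_2 dest!: less_2_cases)

text \<open>\<open>H\<close> is the inverse of the Gram matrix over any field, hence the sign in
  \<open>- a\<close>.\<close>

lemma good_form_beta_2P: "good_form (beta_2P a :: ('k::field, nat \<Rightarrow> 'k) bform)"
  unfolding beta_2P_def
  by (rule good_form_gram[where
        H = "\<lambda>i j. [[0, 0, 0, 1], [0, 0, 1, 0], [0, 1, 0, 0], [1, 0, 0, - a]] ! i ! j"])
    (auto simp: coordinate_obj_P gram_def sum_lessThan_4 algebra_simps dest!: less_4_cases)

section \<open>Invariants of forms\<close>

text \<open>
  Symmetry and \<open>t\<^sup>2 = 0\<close> make \<open>\<beta>\<close> symmetric in the usual sense, so in characteristic 2 both
  \<open>\<beta>(u, u)\<close> and \<open>\<beta>(u, t.u)\<close> are additive in \<open>u\<close>.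
\<close>

definition kernel_alternating :: "('k::field, 'u::ab_group_add) bform \<Rightarrow> bool" where
  "kernel_alternating F \<longleftrightarrow> (\<forall>u\<in>carr (fst F). act (fst F) u = 0 \<longrightarrow> eval_form F u u = 0)"

definition shift_alternating :: "('k::field, 'u::ab_group_add) bform \<Rightarrow> bool" where
  "shift_alternating F \<longleftrightarrow> (\<forall>u\<in>carr (fst F). eval_form F u (act (fst F) u) = 0)"

text \<open>One predicate for two tests: at \<open>y = 0\<close> it expresses that \<open>q\<close>
  vanishes.\<close>

definition proportional :: "'k \<Rightarrow> ('k::field, 'u::ab_group_add) bform \<Rightarrow> bool" where
  "proportional y F \<longleftrightarrow>
     (\<forall>u\<in>carr (fst F). eval_form F u u = y * eval_form F u (act (fst F) u))"

text \<open>A relation in \<open>z\<close> and not a value, because different \<open>e\<close> may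
  give different \<open>z\<close>: on \<open>alpha1 1\<close> both 0 and 1 occur.\<close>

definition shift_norm :: "'k \<Rightarrow> ('k::field, 'u::ab_group_add) bform \<Rightarrow> bool" where
  "shift_norm z F \<longleftrightarrow>
     (\<exists>e\<in>carr (fst F). eval_form F e e = z \<and>
        (\<forall>u\<in>carr (fst F). eval_form F u (act (fst F) u) = (eval_form F u (act (fst F) e))\<^sup>2))"

section \<open>Invariance under isomorphism\<close>

lemma isomorphic_formsE:
  assumes "isomorphic_forms F G"
  obtains f where "isomorphism (fst G) (fst F) f" "morphism (fst G) (fst F) f"
    "carr (fst F) = f ` carr (fst G)" "inj_on f (carr (fst G))"
    "\<And>u v. u \<in> carr (fst G) \<Longrightarrow> v \<in> carr (fst G) \<Longrightarrow> eval_form G u v = eval_form F (f u) (f v)"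
proof -
  obtain f where f: "isomorphism (fst G) (fst F) f"
    "\<forall>\<xi>\<in>carr (tensor_obj (fst G) (fst G)). snd G \<xi> = snd F (tensor_map (fst F) (fst F) f f \<xi>)"
    using assms by (auto simp: isomorphic_forms_def split_beta)
  then obtain g where g: "morphism (fst G) (fst F) f" "morphism (fst F) (fst G) g"
      "\<forall>v\<in>carr (fst F). f (g v) = v"
    by (auto simp: isomorphism_def)
  then have lin: "linear_on (fst G) (fst F) f"
    by (simp add: morphism_def)
  have "carr (fst F) = f ` carr (fst G)"
    using g morphismD(1)[OF g(1)] morphismD(1)[OF g(2)] by force
  moreover have "eval_form G u v = eval_form F (f u) (f v)"
    if "u \<in> carr (fst G)" "v \<in> carr (fst G)" for u v
    using f(2) pure_tensor_mem[OF that] by (simp add: tensor_map_pure[OF lin lin that])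
  ultimately show ?thesis
    using that f(1) g(1) isomorphism_inj_on[OF f(1)] by blast
qed

text \<open>The invariants are built from the pairing, the action of t and the zero vector, all of
  which an isomorphism of forms transports. Injectivity enters for the condition that t kills
  \<open>u\<close>.\<close>

lemma invariants_isomorphic:
  assumes "isomorphic_forms F G" and F: "good_form F" and G: "good_form G"
  shows "kernel_alternating F \<longleftrightarrow> kernel_alternating G"
    and "shift_alternating F \<longleftrightarrow> shift_alternating G"
    and "proportional y F \<longleftrightarrow> proportional y G"
    and "shift_norm z F \<longleftrightarrow> shift_norm z G"
proof -
  obtain f where f: "morphism (fst G) (fst F) f"
    and img: "carr (fst F) = f ` carr (fst G)" and inj: "inj_on f (carr (fst G))"
    and eval: "\<And>u v. u \<in> carr (fst G) \<Longrightarrow> v \<in> carr (fst G) \<Longrightarrow> eval_form G u v = eval_form F (f u) (f v)"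
    using isomorphic_formsE[OF assms(1)] by metis
  note obj = coordinate_objD[OF good_formD(1)[OF G]]
  have "f 0 = 0"
    using f obj(3) linear_on_zero unfolding morphism_def by blast
  then have ker: "f v = 0 \<longleftrightarrow> v = 0" if "v \<in> carr (fst G)" for v
    using inj_on_eq_iff[OF inj that obj(3)] by simp
  show "kernel_alternating F \<longleftrightarrow> kernel_alternating G"
    unfolding kernel_alternating_def img
    by (simp add: eval morphismD(4)[OF f, symmetric] ker obj(6))
  show "shift_alternating F \<longleftrightarrow> shift_alternating G"
    unfolding shift_alternating_def img by (simp add: eval morphismD(4)[OF f, symmetric] obj(6))
  show "proportional y F \<longleftrightarrow> proportional y G"
    unfolding proportional_def img by (simp add: eval morphismD(4)[OF f, symmetric] obj(6))
  show "shift_norm z F \<longleftrightarrow> shift_norm z G"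
    unfolding shift_norm_def img by (simp add: eval morphismD(4)[OF f, symmetric] obj(6))
qed

text \<open>By non-degeneracy two witnesses differ by a vector killed by t. There \<open>q\<close>
  vanishes by \<open>kernel_alternating\<close>, and \<open>q\<close> is additive, so both witnesses
  have the same value.\<close>

lemma shift_norm_unique:
  fixes F :: "('k::field, nat \<Rightarrow> 'k) bform"
  assumes char: "CHAR('k) = 2" and F: "good_form F" and "kernel_alternating F"
    and "shift_norm z F" "shift_norm z' F"
  shows "z = z'"
proof -
  note good = good_formD[OF F] and lin = eval_form_linear[OF F]
  note obj = coordinate_objD[OF good(1)]
  let ?U = "fst F"
  obtain e where e: "e \<in> carr ?U" "eval_form F e e = z"
    "\<And>u. u \<in> carr ?U \<Longrightarrow> eval_form F u (act ?U u) = (eval_form F u (act ?U e))\<^sup>2"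
    using assms(4) by (auto simp: shift_norm_def)
  obtain e' where e': "e' \<in> carr ?U" "eval_form F e' e' = z'"
    "\<And>u. u \<in> carr ?U \<Longrightarrow> eval_form F u (act ?U u) = (eval_form F u (act ?U e'))\<^sup>2"
    using assms(5) by (auto simp: shift_norm_def)
  have mem: "e + e' \<in> carr ?U" using e e' by (intro obj)
  have "act ?U (e + e') = 0"
  proof (rule good(5)[OF obj(6)[OF mem]])
    fix u assume u: "u \<in> carr ?U"
    \<comment> \<open>Both squares equal \<open>r(u)\<close>, so the square of the sum is zero, and
      so is the sum itself.\<close>
    have "(eval_form F u (act ?U e) + eval_form F u (act ?U e'))\<^sup>2 = 0"
      unfolding power2_add[OF char] e(3)[OF u, symmetric] e'(3)[OF u, symmetric]
      by (rule add_self[OF char])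
    then have "eval_form F u (act ?U e + act ?U e') = 0"
      using u e e' by (simp add: lin obj(6))
    then show "eval_form F (act ?U (e + e')) u = 0"
      using good(4)[OF u obj(6)[OF mem]] u e e' by (simp add: obj(7))
  qed
  then have "eval_form F (e + e') (e + e') = 0"
    using assms(3) mem by (simp add: kernel_alternating_def)
  then have "z + z' + (eval_form F e e' + eval_form F e' e) = 0"
    using e e' mem by (simp add: lin algebra_simps)
  then have "z + z' = 0"
    using good(4)[OF e(1) e'(1)] by (simp add: add_self[OF char])
  then show "z = z'"
    unfolding diff_self[OF char, symmetric] by simp
qed

text \<open>Common skeleton of the three equivalences below: one direction tests on the embedded
  vectors \<open>join u 0\<close> and \<open>join 0 u\<close>, the other one adds up the
  components.\<close>

lemma ball_carr_sum:
  assumes "good_form F" "good_form G"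
    and "\<And>u. u \<in> carr (sum_obj (fst F) (fst G)) \<Longrightarrow> Q (evens u) \<and> R (odds u) \<Longrightarrow> P u"
    and "\<And>u. u \<in> carr (fst F) \<Longrightarrow> P (join u 0) \<Longrightarrow> Q u"
    and "\<And>u. u \<in> carr (fst G) \<Longrightarrow> P (join 0 u) \<Longrightarrow> R u"
  shows "(\<forall>u\<in>carr (fst (F \<oplus>\<^sub>f G)). P u) \<longleftrightarrow> (\<forall>u\<in>carr (fst F). Q u) \<and> (\<forall>u\<in>carr (fst G). R u)"
  using assms(3-) join_zero_mem[OF assms(1,2)] unfolding fst_sum_form by (auto simp del: sum_obj_sel) auto

context
  fixes F G :: "('k::field, nat \<Rightarrow> 'k) bform"
  assumes F: "good_form F" and G: "good_form G"
begin

lemma eval_sum_act: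
  assumes "u \<in> carr (sum_obj (fst F) (fst G))" "e \<in> carr (sum_obj (fst F) (fst G))"
  shows "eval_form (F \<oplus>\<^sub>f G) u (act (fst (F \<oplus>\<^sub>f G)) e) =
           eval_form F (evens u) (act (fst F) (evens e)) + eval_form G (odds u) (act (fst G) (odds e))"
  using eval_form_sum[OF assms(1) coordinate_objD(6)[OF coordinate_obj_sum[OF good_formD(1)[OF F]
    good_formD(1)[OF G]] assms(2)]] by simp

lemma kernel_alternating_sum:
  "kernel_alternating (F \<oplus>\<^sub>f G) \<longleftrightarrow> kernel_alternating F \<and> kernel_alternating G"
  unfolding kernel_alternating_def
proof (rule ball_carr_sum[OF F G])
  fix u assume u: "u \<in> carr (sum_obj (fst F) (fst G))"
  then show "act (fst (F \<oplus>\<^sub>f G)) u = 0 \<longrightarrow> eval_form (F \<oplus>\<^sub>f G) u u = 0"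
    if "(act (fst F) (evens u) = 0 \<longrightarrow> eval_form F (evens u) (evens u) = 0) \<and>
      (act (fst G) (odds u) = 0 \<longrightarrow> eval_form G (odds u) (odds u) = 0)"
    using that unfolding eval_form_sum[OF u u] by simp
next
  fix u assume u: "u \<in> carr (fst F)"
    and *: "act (fst (F \<oplus>\<^sub>f G)) (join u 0) = 0 \<longrightarrow> eval_form (F \<oplus>\<^sub>f G) (join u 0) (join u 0) = 0"
  then show "act (fst F) u = 0 \<longrightarrow> eval_form F u u = 0"
    using eval_form_join_zero(1)[OF F G join_zero_mem(1)[OF F G u] u]
      coordinate_objD(9)[OF good_formD(1)[OF G]] by simp
next
  fix u assume u: "u \<in> carr (fst G)"
    and *: "act (fst (F \<oplus>\<^sub>f G)) (join 0 u) = 0 \<longrightarrow> eval_form (F \<oplus>\<^sub>f G) (join 0 u) (join 0 u) = 0"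
  then show "act (fst G) u = 0 \<longrightarrow> eval_form G u u = 0"
    using eval_form_join_zero(2)[OF F G join_zero_mem(2)[OF F G u] u]
      coordinate_objD(9)[OF good_formD(1)[OF F]] by simp
qed

lemma shift_alternating_sum:
  "shift_alternating (F \<oplus>\<^sub>f G) \<longleftrightarrow> shift_alternating F \<and> shift_alternating G"
  unfolding shift_alternating_def
proof (rule ball_carr_sum[OF F G])
  fix u assume u: "u \<in> carr (sum_obj (fst F) (fst G))"
  then show "eval_form (F \<oplus>\<^sub>f G) u (act (fst (F \<oplus>\<^sub>f G)) u) = 0"
    if "eval_form F (evens u) (act (fst F) (evens u)) = 0 \<and>
      eval_form G (odds u) (act (fst G) (odds u)) = 0"
    using that unfolding eval_sum_act[OF u u] by simp
next
  fix u assume u: "u \<in> carr (fst F)"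
    and *: "eval_form (F \<oplus>\<^sub>f G) (join u 0) (act (fst (F \<oplus>\<^sub>f G)) (join u 0)) = 0"
  note ju = join_zero_mem(1)[OF F G u]
  show "eval_form F u (act (fst F) u) = 0"
    using * unfolding eval_sum_act[OF ju ju] evens_join odds_join
    using eval_form_zero(1)[OF G] coordinate_objD(3,9)[OF good_formD(1)[OF G]] by simp
next
  fix u assume u: "u \<in> carr (fst G)"
    and *: "eval_form (F \<oplus>\<^sub>f G) (join 0 u) (act (fst (F \<oplus>\<^sub>f G)) (join 0 u)) = 0"
  note ju = join_zero_mem(2)[OF F G u]
  show "eval_form G u (act (fst G) u) = 0"
    using * unfolding eval_sum_act[OF ju ju] evens_join odds_join
    using eval_form_zero(1)[OF F] coordinate_objD(3,9)[OF good_formD(1)[OF F]] by simp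
qed

lemma proportional_sum:
  "proportional y (F \<oplus>\<^sub>f G) \<longleftrightarrow> proportional y F \<and> proportional y G"
  unfolding proportional_def
proof (rule ball_carr_sum[OF F G])
  fix u assume u: "u \<in> carr (sum_obj (fst F) (fst G))"
  then show "eval_form (F \<oplus>\<^sub>f G) u u = y * eval_form (F \<oplus>\<^sub>f G) u (act (fst (F \<oplus>\<^sub>f G)) u)"
    if "eval_form F (evens u) (evens u) = y * eval_form F (evens u) (act (fst F) (evens u)) \<and>
      eval_form G (odds u) (odds u) = y * eval_form G (odds u) (act (fst G) (odds u))"
    using that unfolding eval_sum_act[OF u u] eval_form_sum[OF u u] by (simp add: distrib_left)
next
  fix u assume u: "u \<in> carr (fst F)"
    and *: "eval_form (F \<oplus>\<^sub>f G) (join u 0) (join u 0) =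
      y * eval_form (F \<oplus>\<^sub>f G) (join u 0) (act (fst (F \<oplus>\<^sub>f G)) (join u 0))"
  note ju = join_zero_mem(1)[OF F G u]
  show "eval_form F u u = y * eval_form F u (act (fst F) u)"
    using * unfolding eval_sum_act[OF ju ju] eval_form_sum[OF ju ju] evens_join odds_join
    using eval_form_zero(1)[OF G] coordinate_objD(3,9)[OF good_formD(1)[OF G]] by simp
next
  fix u assume u: "u \<in> carr (fst G)"
    and *: "eval_form (F \<oplus>\<^sub>f G) (join 0 u) (join 0 u) =
      y * eval_form (F \<oplus>\<^sub>f G) (join 0 u) (act (fst (F \<oplus>\<^sub>f G)) (join 0 u))"
  note ju = join_zero_mem(2)[OF F G u]
  show "eval_form G u u = y * eval_form G u (act (fst G) u)"
    using * unfolding eval_sum_act[OF ju ju] eval_form_sum[OF ju ju] evens_join odds_join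
    using eval_form_zero(1)[OF F] coordinate_objD(3,9)[OF good_formD(1)[OF F]] by simp
qed

text \<open>The witness joins the two witnesses, and the squares add up because squaring is additive
  in characteristic 2.\<close>

lemma shift_norm_sum:
  assumes char: "CHAR('k) = 2" and "shift_norm z F" "shift_norm z' G"
  shows "shift_norm (z + z') (F \<oplus>\<^sub>f G)"
proof -
  obtain e where e: "e \<in> carr (fst F)" "eval_form F e e = z"
    "\<And>u. u \<in> carr (fst F) \<Longrightarrow> eval_form F u (act (fst F) u) = (eval_form F u (act (fst F) e))\<^sup>2"
    using assms(2) by (auto simp: shift_norm_def)
  obtain e' where e': "e' \<in> carr (fst G)" "eval_form G e' e' = z'"
    "\<And>u. u \<in> carr (fst G) \<Longrightarrow> eval_form G u (act (fst G) u) = (eval_form G u (act (fst G) e'))\<^sup>2"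
    using assms(3) by (auto simp: shift_norm_def)
  let ?S = "sum_obj (fst F) (fst G)"
  have j: "join e e' \<in> carr ?S" using e e' by simp
  have "eval_form (F \<oplus>\<^sub>f G) u (act (fst (F \<oplus>\<^sub>f G)) u) =
      (eval_form (F \<oplus>\<^sub>f G) u (act (fst (F \<oplus>\<^sub>f G)) (join e e')))\<^sup>2" if u: "u \<in> carr ?S" for u
  proof -
    have "evens u \<in> carr (fst F)" "odds u \<in> carr (fst G)" using u by auto
    then show ?thesis
      unfolding eval_sum_act[OF u u] eval_sum_act[OF u j] evens_join odds_join power2_add[OF char]
      by (simp only: e(3) e'(3))
  qed
  moreover have "eval_form (F \<oplus>\<^sub>f G) (join e e') (join e e') = z + z'"
    unfolding eval_form_sum[OF j j] evens_join odds_join e e' ..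
  ultimately show ?thesis
    unfolding shift_norm_def fst_sum_form by (intro bexI[OF _ j]) blast
qed

end

section \<open>Invariants of the building blocks\<close>

lemma invariants_zero_form:
  "kernel_alternating zero_form" "shift_alternating zero_form" "proportional y zero_form"
  "shift_norm 0 zero_form"
  by (auto simp: kernel_alternating_def shift_alternating_def proportional_def shift_norm_def
      zero_form_def supported_def)

lemma kernel_alternating_copies:
  "good_form F \<Longrightarrow> kernel_alternating (copies k F) \<longleftrightarrow> k = 0 \<or> kernel_alternating F"
  by (induction k) (auto simp: invariants_zero_form kernel_alternating_sum good_form_copies)

lemma shift_alternating_copies:
  "good_form F \<Longrightarrow> shift_alternating (copies k F) \<longleftrightarrow> k = 0 \<or> shift_alternating F"
  by (induction k) (auto simp: invariants_zero_form shift_alternating_sum good_form_copies)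

lemma proportional_copies:
  "good_form F \<Longrightarrow> proportional y (copies k F) \<longleftrightarrow> k = 0 \<or> proportional y F"
  by (induction k) (auto simp: invariants_zero_form proportional_sum good_form_copies)

text \<open>In (F) only \<beta>_P(0) occurs in variable number, so the value 0 is enough and nothing
  accumulates with \<open>k\<close>.\<close>

lemma shift_norm_copies:
  fixes F :: "('k::field, nat \<Rightarrow> 'k) bform"
  assumes "CHAR('k) = 2" "good_form F" "shift_norm 0 F"
  shows "shift_norm 0 (copies k F)"
proof (induction k)
  case (Suc k)
  from shift_norm_sum[OF good_form_copies[OF assms(2)] assms(2) assms(1) this assms(3)]
  show ?case by simp
qed (simp add: invariants_zero_form)

lemma invariants_alpha1:
  assumes "m > 0"
  shows "\<not> kernel_alternating (alpha1 m :: ('k::field, nat \<Rightarrow> 'k) bform)"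
proof
  let ?u = "unit_vec 0 :: nat \<Rightarrow> 'k"
  have u: "?u \<in> carr (ones_obj m)" using assms by (simp add: supported_def unit_vec_def)
  assume "kernel_alternating (alpha1 m :: ('k::field, nat \<Rightarrow> 'k) bform)"
  then have "eval_form (alpha1 m) ?u ?u = 0"
    using u by (simp add: kernel_alternating_def func_zero)
  then have "(\<Sum>i<m. ?u i * ?u i) = 0"
    using eval_alpha1[OF u u] by simp
  then show False using assms by (simp add: unit_vec_def if_distrib[of "\<lambda>x. x * _"] cong: if_cong)
qed

lemma shift_alternating_ones:
  assumes "good_form F" "fst F = ones_obj m"
  shows "shift_alternating F"
  unfolding shift_alternating_def
proof
  fix u assume "u \<in> carr (fst F)"
  then show "eval_form F u (act (fst F) u) = 0"
    using eval_form_zero(2)[OF assms(1)] by (simp add: assms(2))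
qed

lemma invariants_alpha2:
  assumes char: "CHAR('k::field) = 2" and "even m"
  shows "kernel_alternating (alpha2 m :: ('k, nat \<Rightarrow> 'k) bform)"
    and "shift_alternating (alpha2 m :: ('k, nat \<Rightarrow> 'k) bform)"
    and "proportional y (alpha2 m :: ('k, nat \<Rightarrow> 'k) bform)"
    and "shift_norm 0 (alpha2 m :: ('k, nat \<Rightarrow> 'k) bform)"
proof -
  let ?F = "alpha2 m :: ('k, nat \<Rightarrow> 'k) bform"
  have shift: "eval_form ?F u (act (fst ?F) v) = 0" if "u \<in> carr (fst ?F)" for u v
    using eval_form_zero(2)[OF good_form_alpha2[OF assms(2)] that] by simp
  have diag: "eval_form ?F u u = 0" if "u \<in> carr (fst ?F)" for u
    using that eval_alpha2[OF char] by simp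
  show "kernel_alternating ?F"
    unfolding kernel_alternating_def using diag by blast
  show "shift_alternating ?F"
    unfolding shift_alternating_def using shift by blast
  show "proportional y ?F"
    unfolding proportional_def
  proof
    fix u assume u: "u \<in> carr (fst ?F)"
    show "eval_form ?F u u = y * eval_form ?F u (act (fst ?F) u)"
      unfolding diag[OF u] shift[OF u] by simp
  qed
  have 0: "0 \<in> carr (fst ?F)"
    by (simp add: supported_def)
  show "shift_norm 0 ?F"
    unfolding shift_norm_def
  proof (intro bexI[OF _ 0] conjI ballI)
    show "eval_form ?F 0 0 = 0" by (rule diag[OF 0])
    fix u assume u: "u \<in> carr (fst ?F)"
    show "eval_form ?F u (act (fst ?F) u) = (eval_form ?F u (act (fst ?F) 0))\<^sup>2"
      unfolding shift[OF u] by simp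
  qed
qed

lemma eval_beta_P_act:
  assumes "u \<in> carr (P_obj 1)" "v \<in> carr (P_obj 1)"
  shows "eval_form (beta_P y) u (act (P_obj 1) v) = u 0 * v 0"
proof -
  have "act (P_obj 1) v \<in> carr (P_obj 1)"
    by (rule coordinate_objD(6)[OF coordinate_obj_P assms(2)])
  from eval_beta_P[OF assms(1) this, of y] show ?thesis by simp
qed

text \<open>For u = u_0 w + u_1 t.w one has q(u) = y u_0^2 and r(u) = u_0^2, and t.u = 0 means u_0 =
  0. The witness for \<open>shift_norm\<close> is w, since \<beta>(u, t.w) = u_0.\<close>

lemma invariants_beta_P:
  fixes y z :: "'k::field"
  assumes char: "CHAR('k) = 2"
  shows "kernel_alternating (beta_P y)" "\<not> shift_alternating (beta_P y)"
    and "proportional z (beta_P y) \<longleftrightarrow> z = y"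
    and "shift_norm y (beta_P y)"
proof -
  let ?w = "unit_vec 0 :: nat \<Rightarrow> 'k"
  have w: "?w \<in> carr (P_obj 1)" by (simp add: supported_def unit_vec_def)
  have w0: "?w 0 = 1" "?w 1 = 0" by (simp_all add: unit_vec_def)
  have diag: "eval_form (beta_P y) u u = y * (u 0 * u 0)" if "u \<in> carr (P_obj 1)" for u
    using eval_beta_P[OF that that, of y] add_self[OF char, of "u 0 * u 1"]
    by (simp add: mult.commute mult.left_commute add.assoc)
  note diag = diag[unfolded fst_named_forms] and act = eval_beta_P_act[unfolded fst_named_forms]
  have "u 0 = 0" if "act (P_obj 1) u = 0" for u :: "nat \<Rightarrow> 'k"
    using fun_cong[OF that, of 1] by simp
  then show "kernel_alternating (beta_P y)"
    unfolding kernel_alternating_def fst_named_forms using diag by simp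
  show "\<not> shift_alternating (beta_P y)"
    unfolding shift_alternating_def fst_named_forms
  proof
    assume "\<forall>u\<in>carr (P_obj 1). snd (beta_P y) (pure_tensor (P_obj 1) (P_obj 1) u (act (P_obj 1) u)) = 0"
    from bspec[OF this w] show False unfolding act[OF w w] by (simp add: w0)
  qed
  show "proportional z (beta_P y) \<longleftrightarrow> z = y"
    unfolding proportional_def fst_named_forms
  proof
    assume "\<forall>u\<in>carr (P_obj 1). snd (beta_P y) (pure_tensor (P_obj 1) (P_obj 1) u u) =
      z * snd (beta_P y) (pure_tensor (P_obj 1) (P_obj 1) u (act (P_obj 1) u))"
    from bspec[OF this w] show "z = y"
      unfolding diag[OF w] act[OF w w] by (simp add: w0)
  next
    assume "z = y"
    then show "\<forall>u\<in>carr (P_obj 1). snd (beta_P y) (pure_tensor (P_obj 1) (P_obj 1) u u) =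
        z * snd (beta_P y) (pure_tensor (P_obj 1) (P_obj 1) u (act (P_obj 1) u))"
      by (intro ballI) (simp only: diag act)
  qed
  show "shift_norm y (beta_P y)"
    unfolding shift_norm_def fst_named_forms
    by (intro bexI[OF _ w] conjI ballI)
      (simp_all only: diag act w w0 power2_eq_square mult_1_right)
qed

text \<open>Here q(u) = a u_0^2, while \<open>r\<close> consists of two equal terms u_0 u_2 that
  cancel. So q = z r means q = 0, whatever z is.\<close>

lemma invariants_beta_2P:
  fixes a z :: "'k::field"
  assumes char: "CHAR('k) = 2"
  shows "kernel_alternating (beta_2P a)" "shift_alternating (beta_2P a)"
    and "proportional z (beta_2P a) \<longleftrightarrow> a = 0"
proof -
  let ?w = "unit_vec 0 :: nat \<Rightarrow> 'k"
  have w: "?w \<in> carr (P_obj 2)" by (simp add: supported_def unit_vec_def)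
  have diag: "eval_form (beta_2P a) u u = a * (u 0 * u 0)" if "u \<in> carr (P_obj 2)" for u
    using eval_beta_2P[OF that that, of a] add_self[OF char, of "u 0 * u 3 + u 1 * u 2"]
    by (simp add: algebra_simps)
  have shift: "eval_form (beta_2P a) u (act (P_obj 2) u) = 0" if u: "u \<in> carr (P_obj 2)" for u
  proof -
    have "act (P_obj 2) u \<in> carr (P_obj 2)"
      by (rule coordinate_objD(6)[OF coordinate_obj_P u])
    from eval_beta_2P[OF u this, of a] show ?thesis
      using add_self[OF char, of "u 0 * u 2"] by (simp add: mult.commute)
  qed
  have "u 0 = 0" if "act (P_obj 2) u = 0" for u :: "nat \<Rightarrow> 'k"
    using fun_cong[OF that, of 1] by simp
  then show "kernel_alternating (beta_2P a)"
    unfolding kernel_alternating_def fst_named_forms using diag by simp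
  show "shift_alternating (beta_2P a)"
    unfolding shift_alternating_def fst_named_forms using shift by simp
  have "a = 0" if "\<forall>u\<in>carr (P_obj 2). a * (u 0 * u 0) = 0"
    using bspec[OF that w] by (simp add: unit_vec_def)
  then show "proportional z (beta_2P a) \<longleftrightarrow> a = 0"
    unfolding proportional_def fst_named_forms using diag shift by auto
qed

section \<open>The listed forms\<close>

lemma isomorphic_obj_copies:
  assumes "fst F = P_obj p"
  shows "isomorphic_obj (fst (copies k F)) (P_obj (k * p))"
proof (induction k)
  case 0
  \<comment> \<open>The empty sum lives on \<open>ones_obj 0\<close>, which must be recognised as a
    sum of no copies of P.\<close>
  have "ones_obj 0 = (P_obj 0 :: ('a, nat \<Rightarrow> 'a) obj)"
    by (simp add: ones_obj_def P_obj_def zero_fun_def)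
  then show ?case by (simp add: isomorphic_obj_refl)
next
  case (Suc k)
  have "isomorphic_obj (sum_obj (fst (copies k F)) (P_obj p)) (sum_obj (P_obj (k * p)) (P_obj p))"
    by (intro isomorphic_obj_sum Suc.IH isomorphic_obj_refl)
  from isomorphic_obj_trans[OF this isomorphic_obj_sum_P] show ?case
    by (simp add: assms add.commute)
qed

text \<open>Re-bracketing lets copies of P appended on the right be absorbed into nP; this handles
  the left-nested sums of (D) and (F).\<close>

lemma isomorphic_normal_sum:
  assumes "isomorphic_obj U (normal_obj m n)" "isomorphic_obj V (P_obj p)"
  shows "isomorphic_obj (sum_obj U V) (normal_obj m (n + p))"
  using isomorphic_obj_trans[OF isomorphic_obj_trans[OF isomorphic_obj_sum[OF assms]
        isomorphic_obj_sum_assoc]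
      isomorphic_obj_sum[OF isomorphic_obj_refl isomorphic_obj_sum_P]] .

lemma listed_form_object:
  assumes "admissible l"
  shows "isomorphic_obj (fst (listed_form l)) (normal_obj (ones_mult l) (P_mult l))"
proof -
  have base: "isomorphic_obj (sum_obj (ones_obj m) (fst (copies k F))) (normal_obj m n)"
    if "fst F = P_obj p" "k * p = n" for m k p n and F :: "('a, nat \<Rightarrow> 'a) bform"
    using isomorphic_obj_sum[OF isomorphic_obj_refl isomorphic_obj_copies[OF that(1)]] that(2) by metis
  show ?thesis
  proof (cases l)
    case (FamA m n)
    then show ?thesis using assms base[of "beta_2P 0" 2 "n div 2" n] by simp
  next
    case (FamB m n)
    then show ?thesis using assms base[of "beta_P 0" 1 n n] by simp
  next
    case (FamC m n)
    then show ?thesis using assms base[of "beta_2P 0" 2 "n div 2" n] by simp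
  next
    case (FamD m n)
    have "isomorphic_obj (sum_obj (normal_obj m 2) (fst (copies ((n - 2) div 2) (beta_2P (0 :: 'a)))))
        (normal_obj m (2 + (n - 2) div 2 * 2))"
      by (intro isomorphic_normal_sum isomorphic_obj_refl isomorphic_obj_copies) simp
    \<comment> \<open>Truncated subtraction and division are exact, as \<open>n\<close> is even and
      at least 2.\<close>
    moreover have "2 + (n - 2) div 2 * 2 = n"
      using FamD assms by auto
    ultimately show ?thesis using FamD by (simp only: listed_form.simps fst_sum_form
        fst_named_forms ones_mult.simps P_mult.simps)
  next
    case (FamE m n y)
    then show ?thesis using assms base[of "beta_P y" 1 n n] by simp
  next
    case (FamF m n y)
    have "isomorphic_obj (sum_obj (sum_obj (sum_obj (ones_obj m)
          (fst (copies (n - 2) (beta_P (0 :: 'a))))) (P_obj 1)) (P_obj 1)) (normal_obj m (n - 2 + 1 + 1))"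
      by (intro isomorphic_normal_sum isomorphic_obj_refl base[of _ 1]) simp_all
    moreover have "n - 2 + 1 + 1 = n"
    proof -
      have "2 \<le> n" using FamF assms by simp
      then show ?thesis by arith
    qed
    ultimately show ?thesis using FamF by (simp only: listed_form.simps fst_sum_form
        fst_named_forms ones_mult.simps P_mult.simps)
  qed
qed

lemmas good_named_forms =
  good_form_alpha1 good_form_alpha2 good_form_beta_P good_form_beta_2P good_form_sum good_form_copies

lemma good_form_listed: "admissible l \<Longrightarrow> good_form (listed_form l)"
  by (cases l) (simp_all add: good_named_forms)

lemmas invariants_sum_copies =
  kernel_alternating_sum shift_alternating_sum proportional_sum
  kernel_alternating_copies shift_alternating_copies proportional_copies

lemma invariants_listed:
  fixes l :: "'k::field label"
  assumes char: "CHAR('k) = 2" and "admissible l"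
  shows "kernel_alternating (listed_form l) \<longleftrightarrow> (case l of FamA _ _ \<Rightarrow> False | FamB _ _ \<Rightarrow> False | _ \<Rightarrow> True)"
    and "shift_alternating (listed_form l) \<longleftrightarrow>
           (case l of FamA _ _ \<Rightarrow> True | FamC _ _ \<Rightarrow> True | FamD _ _ \<Rightarrow> True | _ \<Rightarrow> False)"
    and "l = FamC m n \<Longrightarrow> proportional 0 (listed_form l)"
    and "l = FamD m n \<Longrightarrow> \<not> proportional 0 (listed_form l)"
    and "l = FamE m n y \<Longrightarrow> proportional z (listed_form l) \<longleftrightarrow> z = y"
    and "l = FamF m n y \<Longrightarrow> \<not> proportional z (listed_form l)"
    and "l = FamF m n y \<Longrightarrow> shift_norm (1 + y) (listed_form l)"
proof -
  have alpha1: "shift_alternating (alpha1 m :: ('k, nat \<Rightarrow> 'k) bform)" for m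
    by (rule shift_alternating_ones[OF good_form_alpha1 fst_named_forms(1)])
  note inv = invariants_alpha1 alpha1 invariants_alpha2[OF char] invariants_beta_P(1-3)[OF char]
    invariants_beta_2P[OF char]
  show "kernel_alternating (listed_form l) \<longleftrightarrow> (case l of FamA _ _ \<Rightarrow> False | FamB _ _ \<Rightarrow> False | _ \<Rightarrow> True)"
    using assms by (cases l) (simp_all add: invariants_sum_copies good_named_forms inv)
  show "shift_alternating (listed_form l) \<longleftrightarrow>
      (case l of FamA _ _ \<Rightarrow> True | FamC _ _ \<Rightarrow> True | FamD _ _ \<Rightarrow> True | _ \<Rightarrow> False)"
    using assms by (cases l) (simp_all add: invariants_sum_copies good_named_forms inv)
  show "l = FamC m n \<Longrightarrow> proportional 0 (listed_form l)"
    and "l = FamD m n \<Longrightarrow> \<not> proportional 0 (listed_form l)"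
    and "l = FamE m n y \<Longrightarrow> proportional z (listed_form l) \<longleftrightarrow> z = y"
    using assms by (simp_all add: invariants_sum_copies good_named_forms inv)
  show "\<not> proportional z (listed_form l)" if l: "l = FamF m n y"
  proof
    assume "proportional z (listed_form l)"
    \<comment> \<open>The summands \<beta>_P(1) and \<beta>_P(y) force z = 1 and z = y, and any copy
      of \<beta>_P(0) forces z = 0. Hence y = 1 and n = 2, which is the excluded pair because 1 + 1
      = 0.\<close>
    then have "n = 2 \<or> z = 0" "z = 1" "z = y"
      using assms l by (auto simp: invariants_sum_copies good_named_forms inv)
    then show False using assms(2) l add_self[OF char, of 1] by auto
  qed
  show "shift_norm (1 + y) (listed_form l)" if l: "l = FamF m n y"
  proof -
    have m: "even m" using assms l by simp
    note beta = invariants_beta_P(4)[OF char]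
    \<comment> \<open>One term per summand, in the bracketing of the sum: \<alpha>_2^m, the copies
      of \<beta>_P(0), then \<beta>_P(1) and \<beta>_P(y).\<close>
    have "shift_norm (0 + 0 + 1 + y) (listed_form l)"
      unfolding l listed_form.simps
      by (intro shift_norm_sum good_named_forms m char beta shift_norm_copies invariants_alpha2)
    then show ?thesis by simp
  qed
qed

text \<open>The first half guards the encoding: it certifies that the second half compares genuine
  non-degenerate symmetric forms on the intended objects.\<close>

theorem theorem4p25:
  assumes "CHAR('k::alg_closed_field) = 2"
  shows "(\<forall>l :: 'k label. admissible l \<longrightarrow>
            bilinear_form (listed_form l) \<and> symmetric_form (listed_form l) \<and>
            nondegenerate_form (listed_form l) \<and>
            isomorphic_obj (fst (listed_form l)) (sum_obj (ones_obj (ones_mult l)) (P_obj (P_mult l)))) \<and>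
         (\<forall>l l' :: 'k label. admissible l \<and> admissible l' \<and> l \<noteq> l' \<longrightarrow>
            \<not> isomorphic_forms (listed_form l) (listed_form l'))"
proof (intro conjI allI impI notI)
  fix l :: "'k label" assume l: "admissible l"
  note good = good_form_listed[OF l]
  show "bilinear_form (listed_form l)" "symmetric_form (listed_form l)"
      "nondegenerate_form (listed_form l)"
    using good_form_bilinear[OF assms good] good_form_symmetric[OF good]
      good_form_nondegenerate[OF good] by blast+
  show "isomorphic_obj (fst (listed_form l)) (sum_obj (ones_obj (ones_mult l)) (P_obj (P_mult l)))"
    by (rule listed_form_object[OF l])
next
  fix l l' :: "'k label"
  assume "admissible l \<and> admissible l' \<and> l \<noteq> l'" and iso: "isomorphic_forms (listed_form l) (listed_form l')"
  then have l: "admissible l" and l': "admissible l'" and "l \<noteq> l'" by auto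
  note good = good_form_listed[OF l] and good' = good_form_listed[OF l']
  note same = invariants_isomorphic[OF iso good good']
  note inv = invariants_listed[OF assms l] and inv' = invariants_listed[OF assms l']
  \<comment> \<open>The direction is that of \<open>isomorphic_forms\<close>, whose map goes from
    the object of the second form to that of the first.\<close>
  have "isomorphic_obj (fst (listed_form l')) (fst (listed_form l))"
    using iso by (auto simp: isomorphic_forms_def isomorphic_obj_def split_beta)
  then have "isomorphic_obj (normal_obj (ones_mult l') (P_mult l') :: ('k, nat \<Rightarrow> 'k) obj)
      (normal_obj (ones_mult l) (P_mult l))"
    using isomorphic_obj_trans isomorphic_obj_sym[OF listed_form_object[OF l']] listed_form_object[OF l]
    by blast
  then have mult: "ones_mult l = ones_mult l'" "P_mult l = P_mult l'"
    using normal_obj_unique by metis+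
  have norm: "y = y'" if "l = FamF m n y" "l' = FamF m' n' y'" for m n y m' n' y'
  proof -
    have "shift_norm (1 + y) (listed_form l)" "shift_norm (1 + y') (listed_form l)"
      using inv(7)[OF that(1)] inv'(7)[OF that(2)] same(4) by auto
    moreover have "kernel_alternating (listed_form l)"
      using inv(1) that by simp
    ultimately have "1 + y = 1 + y'"
      using shift_norm_unique[OF assms good] by blast
    then show ?thesis by simp
  qed
  \<comment> \<open>The two truth values separate (A), (B), the pair (C), (D) and the pair (E), (F).
    The facts after them separate the members of each pair and the parameters.\<close>
  have "(case l of FamA _ _ \<Rightarrow> False | FamB _ _ \<Rightarrow> False | _ \<Rightarrow> True) =
      (case l' of FamA _ _ \<Rightarrow> False | FamB _ _ \<Rightarrow> False | _ \<Rightarrow> True)"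
    using same(1) inv(1) inv'(1) by simp
  moreover have "(case l of FamA _ _ \<Rightarrow> True | FamC _ _ \<Rightarrow> True | FamD _ _ \<Rightarrow> True | _ \<Rightarrow> False) =
      (case l' of FamA _ _ \<Rightarrow> True | FamC _ _ \<Rightarrow> True | FamD _ _ \<Rightarrow> True | _ \<Rightarrow> False)"
    using same(2) inv(2) inv'(2) by simp
  moreover have "\<nexists>m n m' n'. l = FamC m n \<and> l' = FamD m' n' \<or> l = FamD m n \<and> l' = FamC m' n'"
    using same(3) inv(3,4) inv'(3,4) by blast
  moreover have "\<nexists>m n y m' n' y'. l = FamE m n y \<and> l' = FamF m' n' y' \<or> l = FamF m n y \<and> l' = FamE m' n' y'"
    using same(3) inv(5,6) inv'(5,6) by blast
  moreover have "\<nexists>m n y m' n' y'. l = FamE m n y \<and> l' = FamE m' n' y' \<and> y \<noteq> y'"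
    using same(3) inv(5) inv'(5) by blast
  moreover have "\<nexists>m n y m' n' y'. l = FamF m n y \<and> l' = FamF m' n' y' \<and> y \<noteq> y'"
    using norm by blast
  ultimately show False
    using \<open>l \<noteq> l'\<close> mult by (cases l; cases l') simp_all
qed

end
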